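(* Let $G$ be a Cayley graph of a finitely generated group $\Gamma$, $\eta$ a $\Gamma$-invariant random labelling of $G$, and $\omega$ an $\eta$-measurable percolation process such that $(\eta,\omega)$ is jointly $\Gamma$-invariant. Let $(\eta',\omega')$ be an identically distributed copy of $(\eta,\omega)$ (defined on the same probability space, with an arbitrary coupling), let $x$ and $x'$ be two vertices, and let $E$ be an $(\eta,\eta')$-measurable event on which the cluster $K$ of $x$ in $\omega$ and the cluster $K'$ of $x'$ in $\omega'$ are infinite. Assume that, conditionally on $E$, $\eta$ and $\eta'$ only differ in a finite (random) set $S$ such that $K\setminus S$ and $K'\setminus S$ share at least one infinite connected component $K_0$. Let $\mathscr A$ be a component property. Then, conditionally on $E$, $x$ has type $\mathscr A$ in $\eta$ if and only if $x'$ has type $\mathscr A$ in $\eta'$, up to an event of probability $0$.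
   Context: **Setting.** $\Gamma$ is identified with $V(G)$; $G$ is the left Cayley graph with respect to a finite generating set, and $\Gamma$ acts on $G$ by the automorphisms $g\cdot x=xg^{-1}$. A labelling is an assignment of elements of a fixed Polish space $L$ to the vertices (or edges, or both) of $G$. A percolation process is a random subset of vertices or of edges of $G$; it is $\eta$-measurable if it is a measurable function of $\eta$ (the same function giving $\omega'$ from $\eta'$). Its clusters are its connected components. **Component property.** A measurable set $\mathscr A$ of pairs $(\eta,v)$ (a labelling and a vertex) that is invariant under the diagonal action of $\Gamma$ and such that, for $v,w$ in the same cluster of the percolation $\omega$ determined by $\eta$, $(\eta,v)\in\mathscr A$ iff $(\eta,w)\in\mathscr A$. We say that $v$ has type $\mathscr A$ in $\eta$ if $(\eta,v)\in\mathscr A$. *)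

theory Defs
  imports "HOL-Probability.Probability" "HOL-Algebra.Generated_Groups"
begin

datatype 'g site = Vertex 'g | Edge "'g set"

text \<open>The left Cayley graph: \<open>x\<close> is adjacent to \<open>a x\<close> and \<open>a\<^sup>-\<^sup>1 x\<close> for every generator \<open>a\<close>. It is
  taken to be a simple graph, so a generator equal to the identity produces no loop.\<close>

definition cayley_vertices :: "('g, 'b) monoid_scheme \<Rightarrow> 'g site set"
  where "cayley_vertices \<Gamma> = Vertex ` carrier \<Gamma>"

definition cayley_edges :: "('g, 'b) monoid_scheme \<Rightarrow> 'g set \<Rightarrow> 'g site set"
  where "cayley_edges \<Gamma> A =
    {Edge {x, a \<otimes>\<^bsub>\<Gamma>\<^esub> x} | x a. x \<in> carrier \<Gamma> \<and> a \<in> A \<and> a \<otimes>\<^bsub>\<Gamma>\<^esub> x \<noteq> x}"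

definition cayley_sites :: "('g, 'b) monoid_scheme \<Rightarrow> 'g set \<Rightarrow> 'g site set"
  where "cayley_sites \<Gamma> A = cayley_vertices \<Gamma> \<union> cayley_edges \<Gamma> A"

definition vertex_act :: "('g, 'b) monoid_scheme \<Rightarrow> 'g \<Rightarrow> 'g \<Rightarrow> 'g"
  where "vertex_act \<Gamma> g x = x \<otimes>\<^bsub>\<Gamma>\<^esub> inv\<^bsub>\<Gamma>\<^esub> g"

primrec site_act :: "('g, 'b) monoid_scheme \<Rightarrow> 'g \<Rightarrow> 'g site \<Rightarrow> 'g site"
  where
    "site_act \<Gamma> g (Vertex x) = Vertex (vertex_act \<Gamma> g x)"
  | "site_act \<Gamma> g (Edge e) = Edge (vertex_act \<Gamma> g ` e)"

text \<open>Labellings of a set \<open>D\<close> of sites by elements of the Polish space \<open>'l\<close>, and random subsets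
  of a set \<open>W\<close> of sites, both with the product \<open>\<sigma>\<close>-algebra.\<close>

definition labellings :: "'s set \<Rightarrow> ('s \<Rightarrow> 'l::polish_space) measure"
  where "labellings D = (\<Pi>\<^sub>M s\<in>D. borel)"

definition subset_space :: "'s set \<Rightarrow> 's set measure"
  where "subset_space W = sigma (Pow W) ((\<lambda>s. {\<omega> \<in> Pow W. s \<in> \<omega>}) ` W)"

definition labelling_act ::
    "('g, 'b) monoid_scheme \<Rightarrow> 'g site set \<Rightarrow> 'g \<Rightarrow> ('g site \<Rightarrow> 'l) \<Rightarrow> 'g site \<Rightarrow> 'l"
  where "labelling_act \<Gamma> D g \<eta> = (\<lambda>s\<in>D. \<eta> (site_act \<Gamma> (inv\<^bsub>\<Gamma>\<^esub> g) s))"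

definition subset_act :: "('g, 'b) monoid_scheme \<Rightarrow> 'g \<Rightarrow> 'g site set \<Rightarrow> 'g site set"
  where "subset_act \<Gamma> g \<omega> = site_act \<Gamma> g ` \<omega>"

text \<open>A set \<open>H\<close> of sites stands for the graph whose vertices are the vertices in \<open>H\<close> and whose edges
  are the edges in \<open>H\<close> having both endpoints in \<open>H\<close>. Deleting vertices or edges from a graph is thus
  set difference: edges left without an endpoint are ignored.\<close>

definition vertices_of :: "'g site set \<Rightarrow> 'g set"
  where "vertices_of H = {v. Vertex v \<in> H}"

definition adjacent :: "'g site set \<Rightarrow> ('g \<times> 'g) set"
  where "adjacent H = {(u, v). Vertex u \<in> H \<and> Vertex v \<in> H \<and> Edge {u, v} \<in> H}"

text \<open>The connected component of \<open>v\<close> is a subgraph, comprising both its vertices and its edges; it is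
  empty if \<open>v\<close> is not a vertex of \<open>H\<close>.\<close>

definition component_of :: "'g site set \<Rightarrow> 'g \<Rightarrow> 'g site set"
  where "component_of H v =
    (let C = {u. Vertex v \<in> H \<and> (v, u) \<in> (adjacent H)\<^sup>*}
     in Vertex ` C \<union> {Edge e | e. Edge e \<in> H \<and> e \<subseteq> C})"

definition components :: "'g site set \<Rightarrow> 'g site set set"
  where "components H = component_of H ` vertices_of H"

text \<open>For a percolation \<open>\<omega> \<subseteq> W\<close>, only the sites in \<open>W - \<omega>\<close> are closed. If \<open>W\<close> is the set of vertices this
  gives the subgraph induced by \<open>\<omega>\<close>, and if \<open>W\<close> is the set of edges the spanning subgraph with edge
  set \<open>\<omega>\<close>.\<close>

definition open_graph ::
    "('g, 'b) monoid_scheme \<Rightarrow> 'g set \<Rightarrow> 'g site set \<Rightarrow> 'g site set \<Rightarrow> 'g site set"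
  where "open_graph \<Gamma> A W \<omega> = cayley_sites \<Gamma> A - (W - \<omega>)"

definition cluster ::
    "('g, 'b) monoid_scheme \<Rightarrow> 'g set \<Rightarrow> 'g site set \<Rightarrow> 'g site set \<Rightarrow> 'g \<Rightarrow> 'g site set"
  where "cluster \<Gamma> A W \<omega> v = component_of (open_graph \<Gamma> A W \<omega>) v"

text \<open>Here \<open>f\<close> is the function that determines the percolation from the labelling.\<close>

definition component_property ::
    "('g, 'b) monoid_scheme \<Rightarrow> 'g set \<Rightarrow> 'g site set \<Rightarrow> 'g site set \<Rightarrow>
     (('g site \<Rightarrow> 'l::polish_space) \<Rightarrow> 'g site set) \<Rightarrow> (('g site \<Rightarrow> 'l) \<times> 'g) set \<Rightarrow> bool"
  where "component_property \<Gamma> A D W f \<A> \<longleftrightarrow>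
    \<A> \<in> sets (labellings D \<Otimes>\<^sub>M count_space (carrier \<Gamma>)) \<and>
    (\<forall>g\<in>carrier \<Gamma>. \<forall>\<eta>\<in>space (labellings D). \<forall>v\<in>carrier \<Gamma>.
       (labelling_act \<Gamma> D g \<eta>, vertex_act \<Gamma> g v) \<in> \<A> \<longleftrightarrow> (\<eta>, v) \<in> \<A>) \<and>
    (\<forall>\<eta>\<in>space (labellings D). \<forall>v\<in>carrier \<Gamma>. \<forall>w\<in>vertices_of (cluster \<Gamma> A W (f \<eta>) v).
       (\<eta>, v) \<in> \<A> \<longleftrightarrow> (\<eta>, w) \<in> \<A>)"

end

theory Submission
  imports Defs
begin

text \<open>Put independent uniform labels on the edges, independently of everything else, and let \<open>F\<close> be the
  minimal spanning forest of the open subgraph. Walking around the contour of the trees of \<open>F\<close> is an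
  equivariant injection on the directed edges of \<open>F\<close>, so by mass transport the \<open>i\<close>-th vertex of the contour
  started from a fixed directed edge lies in a rare invariant random set only with small probability,
  uniformly in \<open>i\<close>. The rare set used is the set of vertices at which a finite-range approximation of the type
  fails. The contour of an infinite tree never closes up. Moreover the forests of \<open>\<omega>\<close> and of \<open>\<omega>'\<close> both
  differ from that of \<open>K\<^sub>0\<close> by finitely many edges of \<open>K\<^sub>0\<close>, hence some contour of \<open>K\<^sub>0\<close>
  eventually is a contour for \<open>\<omega>\<close> and for \<open>\<omega>'\<close> at the same time, and it leaves every finite set. Far
  from \<open>S\<close> the approximations for \<open>\<eta>\<close> and \<open>\<eta>'\<close> agree, so if the types differed, all its late vertices
  would be rare for \<open>\<eta>\<close> or for \<open>\<eta>'\<close>.\<close>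

section \<open>Minimal spanning forests\<close>

text \<open>The coupling of \<open>\<eta>\<close> and \<open>\<eta>'\<close> is arbitrary, so no
  invariance of the pair is available: the path along which the two labellings are compared must be
  governed by the law of each process separately and yet be the same path for both. Hence a
  deterministic rule, applied with one and the same family \<open>u\<close> of edge labels to both
  percolations. Each walk is an equivariant function of its own triple (labelling, percolation,
  \<open>u\<close>), and the two triples have the same invariant law. The common starting edge
  depends on both processes and on \<open>u\<close>, but it ranges over a countable set, so a null
  set for every fixed starting edge is enough. For a fixed edge, the event that all late positions
  are rare for one of the processes is no more likely than the bound valid at every single time,
  that is, twice the bound of the mass transport. As the approximation can be made as good as
  desired, the intersection of these events over all accuracies is null.\<close>

definition below :: "('v set \<Rightarrow> 'c::linorder) \<Rightarrow> ('v \<times> 'v) set \<Rightarrow> 'c \<Rightarrow> ('v \<times> 'v) set"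
  where "below U R t = {(c, d) \<in> R. U {c, d} < t}"

text \<open>This is the free minimal spanning forest: an edge is deleted when strictly lighter edges
  join its ends by a finite path, that is, when it is the heaviest edge of a cycle. Graphs are
  symmetric relations, and labels sit on unordered pairs.\<close>

definition msf :: "('v set \<Rightarrow> 'c::linorder) \<Rightarrow> ('v \<times> 'v) set \<Rightarrow> ('v \<times> 'v) set"
  where "msf U R = {(a, b) \<in> R. (a, b) \<notin> (below U R (U {a, b}))\<^sup>*}"

text \<open>Acyclicity in the form that every edge is a bridge, which is how contours exploit it.
  Both orientations have to be removed because relations are symmetric.\<close>

definition forest :: "('v \<times> 'v) set \<Rightarrow> bool"
  where "forest F \<longleftrightarrow> (\<forall>(a, b)\<in>F. (a, b) \<notin> (F - {(a, b), (b, a)})\<^sup>*)"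

definition distinct_labels :: "('v set \<Rightarrow> 'c) \<Rightarrow> ('v \<times> 'v) set \<Rightarrow> bool"
  where "distinct_labels U R \<longleftrightarrow> (\<forall>(a, b)\<in>R. \<forall>(c, d)\<in>R. U {a, b} = U {c, d} \<longrightarrow> {a, b} = {c, d})"

lemma msf_subset: "msf U R \<subseteq> R"
  by (auto simp: msf_def)

lemma sym_below: "sym R \<Longrightarrow> sym (below U R t)"
  by (auto simp: below_def sym_def insert_commute)

lemma sym_rtranclD: "sym R \<Longrightarrow> (a, b) \<in> R\<^sup>* \<Longrightarrow> (b, a) \<in> R\<^sup>*"
  by (meson sym_rtrancl symD)

lemma sym_msf: assumes "sym R" shows "sym (msf U R)"
proof (rule symI)
  fix a b assume ab: "(a, b) \<in> msf U R"
  then have "(b, a) \<notin> (below U R (U {a, b}))\<^sup>*"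
    using sym_rtranclD[OF sym_below[OF assms]] by (auto simp: msf_def)
  with ab assms show "(b, a) \<in> msf U R"
    by (auto simp: msf_def sym_def insert_commute)
qed

lemma below_mono: "Q \<subseteq> R \<Longrightarrow> s \<le> t \<Longrightarrow> below U Q s \<subseteq> below U R t"
  by (auto simp: below_def)

text \<open>A lighter connection inside \<open>Q\<close> is also one inside \<open>R\<close>, so an
  edge that survives in the larger graph survives in the smaller one.\<close>

lemma msf_inter_subset: assumes "Q \<subseteq> R" shows "msf U R \<inter> Q \<subseteq> msf U Q"
  using rtrancl_mono[OF below_mono[OF assms order_refl]] by (fastforce simp: msf_def)

lemma rtrancl_finite_subset:
  assumes "(a, b) \<in> R\<^sup>*"
  obtains X where "finite X" "X \<subseteq> R" "(a, b) \<in> X\<^sup>*"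
proof -
  from assms have "\<exists>X. finite X \<and> X \<subseteq> R \<and> (a, b) \<in> X\<^sup>*"
  proof (induction rule: rtrancl_induct)
    case base then show ?case by (intro exI[of _ "{}"]) auto
  next
    case (step y z)
    then obtain X where "finite X" "X \<subseteq> R" "(a, y) \<in> X\<^sup>*" by auto
    then have "(a, z) \<in> (insert (y, z) X)\<^sup>*"
      by (meson insertI1 rtrancl.rtrancl_into_rtrancl rtrancl_mono subsetD subset_insertI)
    with \<open>finite X\<close> \<open>X \<subseteq> R\<close> step show ?case by (intro exI[of _ "insert (y, z) X"]) auto
  qed
  with that show ?thesis by auto
qed

lemma rtrancl_add_edgeD:
  assumes "sym Y" "(u, v) \<in> (Y \<union> {(a, b), (b, a)})\<^sup>*" "(u, v) \<notin> Y\<^sup>*"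
  shows "((u, a) \<in> Y\<^sup>* \<and> (b, v) \<in> Y\<^sup>*) \<or> ((u, b) \<in> Y\<^sup>* \<and> (a, v) \<in> Y\<^sup>*)"
proof -
  from assms(2) have "(u, v) \<in> Y\<^sup>* \<or> ((u, a) \<in> Y\<^sup>* \<and> (b, v) \<in> Y\<^sup>*) \<or> ((u, b) \<in> Y\<^sup>* \<and> (a, v) \<in> Y\<^sup>*)"
  proof (induction rule: rtrancl_induct)
    case base then show ?case by auto
  next
    case (step y z)
    from step.hyps(2) consider "(y, z) \<in> Y" | "y = a" "z = b" | "y = b" "z = a" by auto
    then show ?case
    proof cases
      case 1 with step.IH show ?thesis by (meson rtrancl.rtrancl_into_rtrancl)
    next
      case 2 with step.IH sym_rtranclD[OF assms(1)] show ?thesis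
        by (meson rtrancl.rtrancl_refl rtrancl_trans)
    next
      case 3 with step.IH sym_rtranclD[OF assms(1)] show ?thesis
        by (meson rtrancl.rtrancl_refl rtrancl_trans)
    qed
  qed
  with assms(3) show ?thesis by auto
qed

text \<open>If an old edge lay on a cycle, the cycle would have to use the new edge, and the rest of
  the cycle would already join \<open>a\<close> to \<open>b\<close> in \<open>Y\<close>.\<close>

lemma forest_add_edge:
  assumes "sym Y" "forest Y" "(a, b) \<notin> Y\<^sup>*"
  shows "forest (Y \<union> {(a, b), (b, a)})"
  unfolding forest_def
proof clarify
  fix u v
  let ?X = "Y \<union> {(a, b), (b, a)}"
  assume uv: "(u, v) \<in> ?X" and conn: "(u, v) \<in> (?X - {(u, v), (v, u)})\<^sup>*"
  have ba: "(b, a) \<notin> Y\<^sup>*" using assms sym_rtranclD by metis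
  show False
  proof (cases "(u, v) \<in> Y")
    case False
    then have "(v, u) \<notin> Y" using assms(1) by (auto simp: sym_def)
    have "{(u, v), (v, u)} = {(a, b), (b, a)}" using uv False by auto
    then have "?X - {(u, v), (v, u)} \<subseteq> Y" by auto
    with conn have "(u, v) \<in> Y\<^sup>*" by (meson rtrancl_mono subsetD)
    with uv False assms(3) ba show False by auto
  next
    case True
    let ?Z = "Y - {(u, v), (v, u)}"
    have symZ: "sym ?Z" using assms(1) by (auto simp: sym_def)
    have "(u, v) \<in> (?Z \<union> {(a, b), (b, a)})\<^sup>*"
      using conn rtrancl_mono[of "?X - {(u, v), (v, u)}" "?Z \<union> {(a, b), (b, a)}"] by auto
    moreover have nZ: "(u, v) \<notin> ?Z\<^sup>*" using assms(2) True by (auto simp: forest_def)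
    ultimately have "((u, a) \<in> ?Z\<^sup>* \<and> (b, v) \<in> ?Z\<^sup>*) \<or> ((u, b) \<in> ?Z\<^sup>* \<and> (a, v) \<in> ?Z\<^sup>*)"
      by (rule rtrancl_add_edgeD[OF symZ])
    moreover have "?Z\<^sup>* \<subseteq> Y\<^sup>*" by (rule rtrancl_mono) auto
    moreover have "(v, u) \<in> Y" using True assms(1) by (auto simp: sym_def)
    ultimately have "(a, b) \<in> Y\<^sup>*"
      using sym_rtranclD[OF assms(1)] True
      by (meson r_into_rtrancl rtrancl_trans subsetD)
    with assms(3) show False by simp
  qed
qed

text \<open>Remove the heaviest edge and induct. By distinctness all remaining edges are strictly
  lighter, so they cannot connect the ends of an edge of \<open>msf U R\<close>, and putting this
  edge back creates no cycle.\<close>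

lemma forest_finite_subset_msf:
  assumes "sym R" "distinct_labels U R"
    and "finite X" "sym X" "X \<subseteq> msf U R"
  shows "forest X"
  using assms(3-)
proof (induction "card X" arbitrary: X rule: less_induct)
  case less
  show ?case
  proof (cases "X = {}")
    case True then show ?thesis by (simp add: forest_def)
  next
    case False
    let ?l = "\<lambda>(c, d). U {c, d}"
    from False \<open>finite X\<close> have "Max (?l ` X) \<in> ?l ` X" by (intro Max_in) auto
    then obtain a b where ab: "(a, b) \<in> X" "U {a, b} = Max (?l ` X)" by auto
    have mx: "U {c, d} \<le> U {a, b}" if "(c, d) \<in> X" for c d
      unfolding ab(2) using that \<open>finite X\<close> by (intro Max_ge) auto
    define Y where "Y = X - {(a, b), (b, a)}"
    have Y: "finite Y" "sym Y" "Y \<subseteq> msf U R" "card Y < card X"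
      using less.prems ab by (auto simp: Y_def sym_def intro!: psubset_card_mono)
    have XY: "X = Y \<union> {(a, b), (b, a)}" using ab less.prems(2) by (auto simp: Y_def sym_def)
    have "Y \<subseteq> below U R (U {a, b})"
    proof clarify
      fix c d assume cd: "(c, d) \<in> Y"
      then have R: "(c, d) \<in> R" "(a, b) \<in> R" "{c, d} \<noteq> {a, b}" "(c, d) \<in> X"
        using less.prems(3) ab msf_subset[of U R] by (auto simp: Y_def doubleton_eq_iff)
      then have "U {c, d} \<noteq> U {a, b}" using assms(2) unfolding distinct_labels_def by blast
      with mx[OF R(4)] R(1) show "(c, d) \<in> below U R (U {a, b})"
        by (simp add: below_def)
    qed
    moreover have "(a, b) \<notin> (below U R (U {a, b}))\<^sup>*" using ab less.prems(3) by (auto simp: msf_def)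
    ultimately have "(a, b) \<notin> Y\<^sup>*" by (meson rtrancl_mono subsetD)
    with forest_add_edge[of Y a b] less.hyps[of Y] Y show ?thesis unfolding XY by auto
  qed
qed

text \<open>A cycle has finitely many edges, so the finite case applies to the symmetric closure of
  an offending path together with the edge that it bypasses.\<close>

lemma forest_msf:
  assumes "sym R" "distinct_labels U R"
  shows "forest (msf U R)"
  unfolding forest_def
proof clarify
  fix a b assume ab: "(a, b) \<in> msf U R" and "(a, b) \<in> (msf U R - {(a, b), (b, a)})\<^sup>*"
  then obtain X where X: "finite X" "X \<subseteq> msf U R - {(a, b), (b, a)}" "(a, b) \<in> X\<^sup>*"
    using rtrancl_finite_subset by metis
  define Y where "Y = X \<union> X\<inverse> \<union> {(a, b), (b, a)}"
  have "forest Y"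
  proof (rule forest_finite_subset_msf[OF assms])
    show "finite Y" "sym Y" using X by (auto simp: Y_def sym_def)
    show "Y \<subseteq> msf U R" using X ab sym_msf[OF assms(1), of U] by (auto simp: Y_def sym_def)
  qed
  moreover have "X \<subseteq> Y - {(a, b), (b, a)}" using X by (auto simp: Y_def)
  ultimately show False using X(3) rtrancl_mono[of X "Y - {(a, b), (b, a)}"]
    by (auto simp: forest_def Y_def)
qed

text \<open>If the tree \<open>C\<close> of \<open>x\<close> were finite, its edge boundary would be
  finite and nonempty. A path of lighter edges between the ends of the lightest boundary edge would
  cross the boundary at a still lighter edge, so that boundary edge belongs to the forest and leads
  out of \<open>C\<close>.\<close>

lemma infinite_msf_component:
  assumes "sym R" and fin: "\<And>v. finite (R `` {v})" and inf: "infinite (R\<^sup>* `` {x})"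
  shows "infinite ((msf U R)\<^sup>* `` {x})"
proof
  define C where "C = (msf U R)\<^sup>* `` {x}"
  assume "finite ((msf U R)\<^sup>* `` {x})"
  then have finC: "finite C" by (simp add: C_def)
  have xC: "x \<in> C" by (auto simp: C_def)
  define B where "B = {(c, d). (c, d) \<in> R \<and> c \<in> C \<and> d \<notin> C}"
  have "B \<subseteq> (SIGMA c:C. R `` {c})" by (auto simp: B_def)
  then have finB: "finite B" by (rule finite_subset) (use finC fin in auto)
  have cross: "\<exists>(c, d)\<in>Q. c \<in> C \<and> d \<notin> C" if "(a, b) \<in> Q\<^sup>*" "a \<in> C" "b \<notin> C" for Q a b
    using that by (induction rule: rtrancl_induct) auto
  from inf finC have "\<not> R\<^sup>* `` {x} \<subseteq> C" using finite_subset by blast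
  then obtain y where "(x, y) \<in> R\<^sup>*" "y \<notin> C" by auto
  from cross[OF this(1) xC this(2)] have "B \<noteq> {}" by (auto simp: B_def)
  let ?l = "\<lambda>(c, d). U {c, d}"
  have "Min (?l ` B) \<in> ?l ` B" using finB \<open>B \<noteq> {}\<close> by (intro Min_in) auto
  then obtain a b where ab: "(a, b) \<in> B" "U {a, b} = Min (?l ` B)" by auto
  have mn: "U {a, b} \<le> U {c, d}" if "(c, d) \<in> B" for c d
    unfolding ab(2) using that finB by (intro Min_le) auto
  have "(a, b) \<in> msf U R"
  proof (rule ccontr)
    assume "(a, b) \<notin> msf U R"
    then have "(a, b) \<in> (below U R (U {a, b}))\<^sup>*" using ab by (auto simp: msf_def B_def)
    from cross[OF this] ab obtain c d where "(c, d) \<in> below U R (U {a, b})" "c \<in> C" "d \<notin> C"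
      by (auto simp: B_def)
    then show False using mn[of c d] by (force simp: below_def B_def)
  qed
  moreover have "a \<in> C" "b \<notin> C" using ab by (auto simp: B_def)
  ultimately show False by (auto simp: C_def intro: rtrancl.rtrancl_into_rtrancl)
qed

text \<open>An edge lost when \<open>H\<close> is enlarged to \<open>R\<close> is the heaviest edge of an \<open>H\<close>-path between two points of the
  boundary \<open>Z\<close>, and for given end points there is only one such edge in the forest of \<open>H\<close>.\<close>

lemma finite_msf_diff:
  assumes "sym H" "H \<subseteq> R" "sym R" "distinct_labels U R" "finite Z"
    and H: "H \<subseteq> V \<times> V" and bd: "\<And>a b. (a, b) \<in> R \<Longrightarrow> a \<in> V - Z \<Longrightarrow> (a, b) \<in> H"
  shows "finite (msf U H - msf U R)"
proof -
  define P where "P = (\<lambda>t (z1, z2). \<exists>a b. (a, b) \<in> msf U H \<and> U {a, b} = t \<and>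
    (a, z1) \<in> (below U H t)\<^sup>* \<and> (b, z2) \<in> (below U H t)\<^sup>*)"
  define T where "T = (\<lambda>(a, b). U {a, b}) ` (msf U H - msf U R)"
  \<comment> \<open>An \<open>R\<close>-path started in \<open>V\<close> stays in \<open>H\<close>
    until it visits \<open>Z\<close>. The ends of a lost edge are joined by lighter edges of
    \<open>R\<close> but not of \<open>H\<close>, so each end is joined to \<open>Z\<close> by
    lighter edges of \<open>H\<close>.\<close>
  have reach: "(a, b) \<in> (below U H t)\<^sup>* \<or> (\<exists>z\<in>Z. (a, z) \<in> (below U H t)\<^sup>*)"
    if "(a, b) \<in> (below U R t)\<^sup>*" "a \<in> V" for a b t
    using that
  proof (induction rule: rtrancl_induct)
    case base then show ?case by auto
  next
    case (step c d)
    show ?case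
    proof (cases "\<exists>z\<in>Z. (a, z) \<in> (below U H t)\<^sup>*")
      case False
      with step have ac: "(a, c) \<in> (below U H t)\<^sup>*" by auto
      have "c \<in> V" using ac \<open>a \<in> V\<close> H by (cases rule: rtranclE) (auto simp: below_def)
      moreover have "c \<notin> Z" using False ac by auto
      ultimately have "(c, d) \<in> below U H t" using step.hyps bd by (auto simp: below_def)
      with ac show ?thesis by (meson rtrancl.rtrancl_into_rtrancl)
    qed auto
  qed
  have "\<exists>p\<in>Z \<times> Z. P t p" if "t \<in> T" for t
  proof -
    from that obtain a b where ab: "(a, b) \<in> msf U H" "(a, b) \<notin> msf U R" "t = U {a, b}"
      by (auto simp: T_def)
    have aH: "(a, b) \<in> H" using ab msf_subset[of U H] by auto
    then have V: "a \<in> V" "b \<in> V" using H by auto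
    have conn: "(a, b) \<in> (below U R t)\<^sup>*" using ab aH assms(2) by (auto simp: msf_def)
    have nconn: "(a, b) \<notin> (below U H t)\<^sup>*" using ab by (auto simp: msf_def)
    have "(b, a) \<in> (below U R t)\<^sup>*" using conn sym_rtranclD[OF sym_below[OF assms(3)]] by metis
    moreover have "(b, a) \<notin> (below U H t)\<^sup>*" using nconn sym_rtranclD[OF sym_below[OF assms(1)]] by metis
    ultimately obtain z1 z2 where "z1 \<in> Z" "(a, z1) \<in> (below U H t)\<^sup>*" "z2 \<in> Z" "(b, z2) \<in> (below U H t)\<^sup>*"
      using reach conn nconn V by metis
    with ab show ?thesis by (intro bexI[of _ "(z1, z2)"]) (auto simp: P_def)
  qed
  then obtain f where f: "\<And>t. t \<in> T \<Longrightarrow> f t \<in> Z \<times> Z \<and> P t (f t)" by metis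
  \<comment> \<open>Of two lost edges attached to the same pair, the lighter one completes a path
    from \<open>a'\<close> through \<open>z1\<close> and \<open>z2\<close> to \<open>b'\<close> with
    all labels below \<open>t'\<close>, which deletes the heavier one.\<close>
  have less: False if "P t (z1, z2)" "P t' (z1, z2)" "t < t'" for t t' z1 z2
  proof -
    note sy = sym_rtranclD[OF sym_below[OF assms(1)]]
    have m: "(below U H t)\<^sup>* \<subseteq> (below U H t')\<^sup>*" using that(3) by (intro rtrancl_mono below_mono) auto
    from that obtain a b a' b' where
      1: "(a, b) \<in> msf U H" "U {a, b} = t" "(a, z1) \<in> (below U H t)\<^sup>*" "(b, z2) \<in> (below U H t)\<^sup>*" and
      2: "(a', b') \<in> msf U H" "U {a', b'} = t'" "(a', z1) \<in> (below U H t')\<^sup>*" "(b', z2) \<in> (below U H t')\<^sup>*"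
      unfolding P_def by auto
    have "(a, b) \<in> below U H t'" using 1 that(3) msf_subset[of U H] by (auto simp: below_def)
    moreover have "(z1, a) \<in> (below U H t')\<^sup>*" using sy 1(3) m by blast
    moreover have "(b, z2) \<in> (below U H t')\<^sup>*" using 1(4) m by blast
    moreover have "(z2, b') \<in> (below U H t')\<^sup>*" using sy 2(4) by blast
    ultimately have "(a', b') \<in> (below U H t')\<^sup>*"
      using 2(3) by (meson r_into_rtrancl rtrancl_trans)
    then show False using 2 by (auto simp: msf_def)
  qed
  have "inj_on f T"
  proof (rule inj_onI)
    fix t t' assume "t \<in> T" "t' \<in> T" "f t = f t'"
    then show "t = t'" using f less by (metis linorder_neqE surj_pair)
  qed
  moreover have "finite (f ` T)"
    by (rule finite_subset[of _ "Z \<times> Z"]) (use f assms(5) in blast)+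
  ultimately have "finite T" by (rule finite_imageD[rotated])
  \<comment> \<open>Finitely many labels leave finitely many unordered edges, because labels are
    distinct, and each of these has at most two orientations.\<close>
  let ?E = "(\<lambda>(a, b). {a, b}) ` (msf U H - msf U R)"
  have finE: "finite ?E"
  proof (rule finite_imageD)
    have "U ` ?E = T" by (simp add: T_def image_image case_prod_unfold)
    with \<open>finite T\<close> show "finite (U ` ?E)" by simp
    show "inj_on U ?E"
    proof (rule inj_onI)
      fix e e' assume "e \<in> ?E" "e' \<in> ?E" and eq: "U e = U e'"
      then obtain a b c d where e: "(a, b) \<in> msf U H" "e = {a, b}" "(c, d) \<in> msf U H" "e' = {c, d}"
        by auto
      then have "(a, b) \<in> R" "(c, d) \<in> R" using assms(2) msf_subset[of U H] by auto
      with assms(4) eq e(2,4) show "e = e'" unfolding distinct_labels_def by blast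
    qed
  qed
  have "msf U H - msf U R \<subseteq> \<Union>?E \<times> \<Union>?E" by auto
  then show ?thesis by (rule finite_subset) (use finE in auto)
qed

section \<open>Contours of forests\<close>

definition cyclic_perm :: "('v \<Rightarrow> 'v) \<Rightarrow> 'v set \<Rightarrow> bool"
  where "cyclic_perm \<pi> N \<longleftrightarrow> inj_on \<pi> N \<and> \<pi> ` N \<subseteq> N \<and> (\<forall>x\<in>N. \<forall>y\<in>N. \<exists>i. (\<pi> ^^ i) x = y)"

text \<open>The face permutation of a ribbon graph: arriving at \<open>q\<close> from
  \<open>p\<close>, leave along the edge that follows \<open>p\<close> in the cyclic order at
  \<open>q\<close>. The order may depend only on \<open>q\<close> and its neighbours, so two forests
  that agree around \<open>q\<close> continue in the same way there.\<close>

definition contour :: "('v \<Rightarrow> 'v set \<Rightarrow> 'v \<Rightarrow> 'v) \<Rightarrow> ('v \<times> 'v) set \<Rightarrow> 'v \<times> 'v \<Rightarrow> 'v \<times> 'v"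
  where "contour \<tau> F = (\<lambda>(p, q). (q, \<tau> q (F `` {q}) p))"

locale contour_graph =
  fixes \<tau> :: "'v \<Rightarrow> 'v set \<Rightarrow> 'v \<Rightarrow> 'v" and F :: "('v \<times> 'v) set"
  assumes sym: "sym F"
    and cyclic: "\<And>p q. (p, q) \<in> F \<Longrightarrow> cyclic_perm (\<tau> q (F `` {q})) (F `` {q})"
begin

lemma flip: "(a, b) \<in> F \<longleftrightarrow> (b, a) \<in> F"
  using sym by (auto simp: sym_def)

lemma contour_in: "e \<in> F \<Longrightarrow> contour \<tau> F e \<in> F"
proof (cases e)
  case (Pair p q)
  assume "e \<in> F"
  then have "(p, q) \<in> F" "p \<in> F `` {q}" using Pair flip by auto
  with cyclic have "\<tau> q (F `` {q}) p \<in> F `` {q}" by (auto simp: cyclic_perm_def)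
  with Pair show ?thesis by (auto simp: contour_def)
qed

lemma inj_on_contour: "inj_on (contour \<tau> F) F"
proof (rule inj_onI, clarify)
  fix a b c d assume F: "(a, b) \<in> F" "(c, d) \<in> F" and eq: "contour \<tau> F (a, b) = contour \<tau> F (c, d)"
  then have "b = d" and t: "\<tau> b (F `` {b}) a = \<tau> b (F `` {b}) c" by (auto simp: contour_def)
  then have "a \<in> F `` {b}" "c \<in> F `` {b}" using F flip by auto
  with t cyclic[OF F(1)] have "a = c" by (auto simp: cyclic_perm_def dest: inj_onD)
  with \<open>b = d\<close> show "a = c \<and> b = d" by simp
qed

lemma contour_pow_in: "e \<in> F \<Longrightarrow> (contour \<tau> F ^^ i) e \<in> F"
  by (induction i) (auto intro: contour_in)

lemma inj_on_contour_pow: "inj_on (contour \<tau> F ^^ i) F"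
proof (induction i)
  case (Suc i)
  have "inj_on (contour \<tau> F) ((contour \<tau> F ^^ i) ` F)"
    by (rule inj_on_subset[OF inj_on_contour]) (use contour_pow_in in auto)
  with Suc have "inj_on (contour \<tau> F \<circ> contour \<tau> F ^^ i) F" by (rule comp_inj_on)
  then show ?case by (simp add: comp_def)
qed auto

lemma fst_contour_Suc: "fst ((contour \<tau> F ^^ Suc i) e) = snd ((contour \<tau> F ^^ i) e)"
  by (simp add: contour_def case_prod_unfold)

text \<open>A periodic orbit must recross every edge that it crosses, since each edge of a forest is a
  bridge. As the rotation at a vertex is transitive, the orbit then exhausts its component.\<close>

lemma inj_contour_orbit:
  assumes "forest F" and e: "(a, b) \<in> F" and inf: "infinite (F\<^sup>* `` {b})"
  shows "inj (\<lambda>i. (contour \<tau> F ^^ i) (a, b))"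
proof (rule ccontr)
  let ?s = "contour \<tau> F"
  define Q where "Q = range (\<lambda>i. (?s ^^ i) (a, b))"
  have QF: "Q \<subseteq> F" using e contour_pow_in by (auto simp: Q_def)
  have Os: "?s d \<in> Q" if "d \<in> Q" for d
  proof -
    from that obtain i where "d = (?s ^^ i) (a, b)" by (auto simp: Q_def)
    then have "?s d = (?s ^^ Suc i) (a, b)" by simp
    then show ?thesis unfolding Q_def by blast
  qed
  then have Osi: "(?s ^^ i) d \<in> Q" if "d \<in> Q" for d i
    using that by (induction i) auto
  assume "\<not> inj (\<lambda>i. (?s ^^ i) (a, b))"
  then obtain i j where ij: "i < j" "(?s ^^ i) (a, b) = (?s ^^ j) (a, b)"
    by (metis (mono_tags, lifting) injI linorder_neqE_nat)
  define n where "n = j - i"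
  \<comment> \<open>Injectivity of the iterates cancels the first \<open>i\<close> steps, so a
    repetition makes the orbit periodic from its start.\<close>
  have "(?s ^^ i) ((?s ^^ n) (a, b)) = (?s ^^ i) (a, b)"
    using ij fun_cong[OF funpow_add[of i n ?s], of "(a, b)"] by (simp add: n_def)
  then have per: "(?s ^^ n) (a, b) = (a, b)"
    using inj_onD[OF inj_on_contour_pow[of i]] contour_pow_in e by blast
  have "n > 0" using ij by (simp add: n_def)
  have perO: "(?s ^^ n) d = d" if "d \<in> Q" for d
  proof -
    from that obtain k where "d = (?s ^^ k) (a, b)" by (auto simp: Q_def)
    moreover have "(?s ^^ n) ((?s ^^ k) (a, b)) = (?s ^^ k) ((?s ^^ n) (a, b))"
      by (simp add: add.commute flip: funpow_add[THEN fun_cong, unfolded o_apply])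
    ultimately show ?thesis using per by simp
  qed
  have "Q \<subseteq> (\<lambda>i. (?s ^^ i) (a, b)) ` {..<n}"
  proof (clarsimp simp: Q_def)
    fix k
    have "(?s ^^ k) (a, b) = (?s ^^ (k mod n)) (a, b)"
      using funpow_mod_eq[OF per] by simp
    then show "(?s ^^ k) (a, b) \<in> (\<lambda>i. (?s ^^ i) (a, b)) ` {..<n}"
      using \<open>n > 0\<close> by auto
  qed
  then have "finite Q" by (rule finite_subset) auto
  \<comment> \<open>By periodicity the orbit comes back to \<open>b\<close> after crossing
    \<open>(b, c)\<close>. If it never crossed the edge backwards, its part from \<open>c\<close> to
    the first return would avoid the edge in both directions, although the edge is a bridge.\<close>
  have recross: "(c, b) \<in> Q" if Q: "(b, c) \<in> Q" for b c
  proof (rule ccontr)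
    assume not: "(c, b) \<notin> Q"
    define h where "h i = snd ((?s ^^ i) (b, c))" for i
    have edge: "(?s ^^ Suc i) (b, c) = (h i, h (Suc i))" for i
      by (metis fst_contour_Suc h_def prod.collapse)
    \<comment> \<open>After \<open>n\<close> steps the orbit is on \<open>(b, c)\<close> again, so
      directed edge number \<open>n - 1\<close> has head \<open>b\<close>. This ensures that the
      first return time \<open>k\<close> exists.\<close>
    obtain m where m: "n = Suc m" using \<open>n > 0\<close> by (cases n) auto
    have "h m = b" using perO[OF Q] edge[of m] m by simp
    define k where "k = (LEAST i. h i = b)"
    have hk: "h k = b" unfolding k_def using \<open>h m = b\<close> by (rule LeastI)
    have "(c, h j) \<in> (F - {(c, b), (b, c)})\<^sup>*" if "j \<le> k" for j
      using that
    proof (induction j)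
      case 0 then show ?case by (simp add: h_def)
    next
      case (Suc j)
      have "h j \<noteq> b" using Suc.prems not_less_Least[of j "\<lambda>i. h i = b"] by (simp add: k_def)
      moreover have "(h j, h (Suc j)) \<in> Q" using Osi[OF Q, of "Suc j"] edge by metis
      ultimately have "(h j, h (Suc j)) \<in> F - {(c, b), (b, c)}" using QF not by auto
      with Suc show ?case by (meson Suc_leD rtrancl.rtrancl_into_rtrancl)
    qed
    from this[of k] hk have "(c, b) \<in> (F - {(c, b), (b, c)})\<^sup>*" by simp
    moreover have "(c, b) \<in> F" using Q QF flip by auto
    ultimately show False using assms(1) by (auto simp: forest_def)
  qed
  \<comment> \<open>Whenever the orbit leaves \<open>q\<close> along an edge, it also re-enters
    \<open>q\<close> along the reverse edge and turns on from there. Thus it enters \<open>q\<close>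
    from all iterates of \<open>p\<close> under the rotation, that is, from all neighbours.\<close>
  have closed: "(q, r) \<in> Q" if "(p, q) \<in> Q" "(q, r) \<in> F" for p q r
  proof -
    let ?\<pi> = "\<tau> q (F `` {q})"
    have orb: "((?\<pi> ^^ i) p, q) \<in> Q" for i
    proof (induction i)
      case (Suc i)
      have "(q, (?\<pi> ^^ Suc i) p) \<in> Q" using Os[OF Suc] by (simp add: contour_def)
      then show ?case by (rule recross)
    qed (use that in simp)
    have "(p, q) \<in> F" using that QF by auto
    then have "cyclic_perm ?\<pi> (F `` {q})" "p \<in> F `` {q}" "r \<in> F `` {q}"
      using cyclic that flip[of p q] by auto
    then obtain i where "(?\<pi> ^^ i) p = r" unfolding cyclic_perm_def by blast
    with orb[of i] show ?thesis by (auto intro: recross)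
  qed
  have "(a, b) \<in> Q" by (auto simp: Q_def intro: image_eqI[of _ _ 0])
  have "c \<in> snd ` Q" if "(b, c) \<in> F\<^sup>*" for c
    using that
  proof (induction rule: rtrancl_induct)
    case base with \<open>(a, b) \<in> Q\<close> show ?case by force
  next
    case (step c d)
    then obtain p where "(p, c) \<in> Q" by auto
    from closed[OF this step(2)] show ?case by force
  qed
  then have "F\<^sup>* `` {b} \<subseteq> snd ` Q" by auto
  with \<open>finite Q\<close> inf show False by (meson finite_imageI finite_subset)
qed

text \<open>Only finitely many directed edges of \<open>F\<close> end in \<open>Y\<close>, and an
  injective orbit uses each of them at most once.\<close>

lemma contour_leaves_finite:
  assumes fin: "\<And>v. finite (F `` {v})" and "e \<in> F"
    and inj: "inj (\<lambda>i. (contour \<tau> F ^^ i) e)" and "finite Y"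
  shows "\<forall>\<^sub>F i in sequentially. snd ((contour \<tau> F ^^ i) e) \<notin> Y"
proof -
  let ?I = "{i. snd ((contour \<tau> F ^^ i) e) \<in> Y}"
  have "(\<lambda>i. (contour \<tau> F ^^ i) e) ` ?I \<subseteq> (\<Union>y\<in>Y. F `` {y} \<times> {y})"
  proof
    fix d assume "d \<in> (\<lambda>i. (contour \<tau> F ^^ i) e) ` ?I"
    then have "snd d \<in> Y" "d \<in> F" using contour_pow_in[OF assms(2)] by auto
    then show "d \<in> (\<Union>y\<in>Y. F `` {y} \<times> {y})" by (cases d) (auto simp: flip)
  qed
  then have "finite ((\<lambda>i. (contour \<tau> F ^^ i) e) ` ?I)"
    by (rule finite_subset) (use fin \<open>finite Y\<close> in auto)
  then have "finite ?I" by (rule finite_imageD) (use inj in \<open>auto simp: inj_on_def\<close>)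
  then show ?thesis by (simp add: eventually_cofinite flip: cofinite_eq_sequentially)
qed

end

text \<open>Off \<open>Z\<close> every \<open>R\<close>-edge at \<open>q\<close> is an
  \<open>H\<close>-edge, so enlarging the graph adds no forest edge at \<open>q\<close>; the second
  condition on \<open>q\<close> says that none is lost there either.\<close>

lemma msf_neighbours_eq:
  assumes "sym H" "sym R" "H \<subseteq> R"
    and bd: "\<And>a b. (a, b) \<in> R \<Longrightarrow> a \<in> V - Z \<Longrightarrow> (a, b) \<in> H"
    and q: "q \<in> V - Z" "q \<notin> snd ` (msf U H - msf U R)"
  shows "msf U R `` {q} = msf U H `` {q}"
proof -
  have "(q, r) \<in> msf U H" if "(q, r) \<in> msf U R" for r
    using that bd[of q r] q(1) msf_inter_subset[OF assms(3), of U] msf_subset[of U R] by auto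
  moreover have "(q, r) \<in> msf U R" if "(q, r) \<in> msf U H" for r
  proof (rule ccontr)
    assume "(q, r) \<notin> msf U R"
    then have "(r, q) \<in> msf U H - msf U R"
      using that sym_msf[OF assms(1), of U] sym_msf[OF assms(2), of U] by (auto simp: sym_def)
    with q(2) show False by force
  qed
  ultimately show ?thesis by auto
qed

text \<open>A contour step depends only on the neighbours of the current head, and these differ
  between the forests of \<open>H\<close> and of \<open>R\<close> at finitely many vertices at most.
  An injective contour of \<open>H\<close> eventually avoids all of them, and from then on it is a
  contour of every forest in the family.\<close>

lemma common_contour:
  fixes \<tau> :: "'v \<Rightarrow> 'v set \<Rightarrow> 'v \<Rightarrow> 'v" and U :: "'v set \<Rightarrow> 'c::linorder"
  assumes R: "\<And>R. R \<in> \<R> \<Longrightarrow> sym R \<and> distinct_labels U R \<and> R \<subseteq> X \<times> X \<and> (\<forall>v. finite (R `` {v})) \<and> H \<subseteq> R"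
    and fin: "finite \<R>" "\<R> \<noteq> {}"
    and "sym H" "H \<subseteq> V \<times> V" "finite Z" "infinite (H\<^sup>* `` {v})"
    and bd: "\<And>R a b. R \<in> \<R> \<Longrightarrow> (a, b) \<in> R \<Longrightarrow> a \<in> V - Z \<Longrightarrow> (a, b) \<in> H"
    and cyc: "\<And>q N. q \<in> X \<Longrightarrow> N \<subseteq> X \<Longrightarrow> finite N \<Longrightarrow> cyclic_perm (\<tau> q N) N"
  obtains e g where "\<And>R i. R \<in> \<R> \<Longrightarrow> (contour \<tau> (msf U R) ^^ i) e = g i" "\<And>R. R \<in> \<R> \<Longrightarrow> e \<in> msf U R"
    "\<And>i. g i \<in> H" "\<And>Y. finite Y \<Longrightarrow> \<forall>\<^sub>F i in sequentially. snd (g i) \<notin> Y"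
proof -
  have cg: "contour_graph \<tau> (msf U Q)" if "sym Q" "Q \<subseteq> X \<times> X" "\<And>v. finite (Q `` {v})" for Q
  proof
    show "sym (msf U Q)" by (rule sym_msf) fact
    fix p q assume "(p, q) \<in> msf U Q"
    then show "cyclic_perm (\<tau> q (msf U Q `` {q})) (msf U Q `` {q})"
      using that(2) msf_subset[of U Q] finite_subset[OF _ that(3)[of q], of "msf U Q `` {q}"]
      by (intro cyc) auto
  qed
  from fin obtain R0 where R0: "R0 \<in> \<R>" by auto
  have HR0: "H \<subseteq> R0" using R[OF R0] by simp
  have H: "H \<subseteq> X \<times> X" "distinct_labels U H" "finite (H `` {v})" for v
  proof -
    show "H \<subseteq> X \<times> X" using R[OF R0] HR0 by blast
    show "distinct_labels U H" using R[OF R0] HR0 unfolding distinct_labels_def by blast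
    show "finite (H `` {v})" by (rule finite_subset[of _ "R0 `` {v}"]) (use R[OF R0] HR0 in auto)
  qed
  interpret H: contour_graph \<tau> "msf U H" using cg[OF assms(4) H(1,3)] .
  have infH: "infinite ((msf U H)\<^sup>* `` {v})"
    using assms(4) H(3) assms(7) by (rule infinite_msf_component)
  obtain w where "(v, w) \<in> msf U H"
  proof (rule ccontr)
    assume "\<not> thesis"
    then have "(msf U H)\<^sup>* `` {v} \<subseteq> {v}" using that by (auto elim: converse_rtranclE)
    with infH show False by (meson finite.emptyI finite.insertI finite_subset)
  qed
  \<comment> \<open>The starting edge points towards \<open>v\<close> because injectivity of the
    orbit is derived from the infinite tree at the head of the edge.\<close>
  then have e0: "(w, v) \<in> msf U H" by (simp add: H.flip)
  define k where "k i = (contour \<tau> (msf U H) ^^ i) (w, v)" for i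
  have injk: "inj k"
    using H.inj_contour_orbit[OF forest_msf[OF assms(4) H(2)] e0 infH] by (simp add: k_def[abs_def])
  have finF: "finite (msf U H `` {v})" for v
    using finite_subset[OF _ H(3)[of v], of "msf U H `` {v}"] msf_subset[of U H] by auto
  have kin: "k i \<in> msf U H" for i using H.contour_pow_in[OF e0] by (simp add: k_def)
  have ev: "\<forall>\<^sub>F i in sequentially. snd (k i) \<notin> Y" if "finite Y" for Y
    using H.contour_leaves_finite[OF finF e0 _ that] injk unfolding k_def[abs_def] by simp
  \<comment> \<open>The vertices at which some forest may turn differently: the boundary
    \<open>Z\<close> and the ends of the edges that are lost in passing from \<open>H\<close> to
    some \<open>R\<close>.\<close>
  define Y where "Y = Z \<union> (\<Union>R\<in>\<R>. snd ` (msf U H - msf U R))"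
  have "finite (msf U H - msf U R)" if "R \<in> \<R>" for R
    by (rule finite_msf_diff[OF assms(4) _ _ _ assms(6,5)]) (use R[OF that] bd[OF that] in auto)
  then have "finite Y" using fin assms(6) by (auto simp: Y_def)
  from ev[OF this] obtain j where j: "\<And>i. i \<ge> j \<Longrightarrow> snd (k i) \<notin> Y"
    by (auto simp: eventually_sequentially)
  define g where "g i = k (i + j)" for i
  have gH: "g i \<in> msf U H" for i using kin by (simp add: g_def)
  have step: "g (Suc i) = contour \<tau> (msf U R) (g i)" if "R \<in> \<R>" for R i
  proof -
    have "snd (g i) \<in> V - Z" using gH[of i] assms(5) msf_subset[of U H] j[of "i + j"]
      by (cases "g i") (auto simp: Y_def g_def)
    moreover have "snd (g i) \<notin> snd ` (msf U H - msf U R)" using j[of "i + j"] that by (auto simp: Y_def g_def)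
    ultimately have "msf U R `` {snd (g i)} = msf U H `` {snd (g i)}"
      using R[OF that] assms(4) bd[OF that] by (intro msf_neighbours_eq[of H R V Z]) auto
    then show ?thesis by (simp add: g_def k_def contour_def case_prod_unfold)
  qed
  show ?thesis
  proof (rule that)
    show "(contour \<tau> (msf U R) ^^ i) (g 0) = g i" if "R \<in> \<R>" for R i
      by (induction i) (simp_all add: step[OF that])
    show "g 0 \<in> msf U R" if "R \<in> \<R>" for R
      using gH[of 0] j[of j] that by (force simp: Y_def g_def)
    show "g i \<in> H" for i using gH msf_subset[of U H] by auto
    show "\<forall>\<^sub>F i in sequentially. snd (g i) \<notin> Y" if "finite Y" for Y
      unfolding g_def using ev[OF that] by (subst eventually_sequentially_seg)
  qed
qed

lemma rtrancl_image:
  assumes "\<And>x y. (x, y) \<in> R \<Longrightarrow> (f x, f y) \<in> S" "(a, b) \<in> R\<^sup>*"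
  shows "(f a, f b) \<in> S\<^sup>*"
  using assms(2) by (induction rule: rtrancl_induct) (auto intro: assms(1) rtrancl.rtrancl_into_rtrancl)

text \<open>The shift by one modulo the cardinality, carried over by an enumeration of
  \<open>X\<close>.\<close>

lemma ex_cyclic_perm:
  assumes "finite X"
  obtains \<pi> where "cyclic_perm \<pi> X"
proof -
  obtain h where h: "bij_betw h {..<card X} X"
    using ex_bij_betw_nat_finite[OF assms] by (auto simp: atLeast0LessThan)
  define n where "n = card X"
  define k where "k = the_inv_into {..<n} h"
  define \<pi> where "\<pi> x = h ((k x + 1) mod n)" for x
  have kh: "k (h i) = i" if "i < n" for i
    using h that by (auto simp: k_def n_def bij_betw_def the_inv_into_f_f)
  have hX: "h i \<in> X" if "i < n" for i using h that by (auto simp: n_def bij_betw_def)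
  have ex: "\<exists>i<n. x = h i" if "x \<in> X" for x using h that by (auto simp: n_def bij_betw_def)
  have pow: "(\<pi> ^^ j) (h i) = h ((i + j) mod n)" if "i < n" for i j
    using that by (induction j) (auto simp: \<pi>_def kh mod_simps)
  have "inj_on \<pi> X"
  proof (rule inj_onI)
    fix x y assume "x \<in> X" "y \<in> X" "\<pi> x = \<pi> y"
    then obtain i j where ij: "i < n" "j < n" "x = h i" "y = h j" "h ((i + 1) mod n) = h ((j + 1) mod n)"
      using ex kh by (metis \<pi>_def)
    then have "(i + 1) mod n = (j + 1) mod n"
      by (metis kh mod_less_divisor gr_implies_not_zero gr0I)
    then have "i = j" using ij by (metis Suc_eq_plus1 mod_Suc mod_less nat.inject nat.distinct(1))
    with ij show "x = y" by simp
  qed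
  moreover have "\<pi> ` X \<subseteq> X" using ex hX pow[of _ 1] by fastforce
  moreover have "\<exists>i. (\<pi> ^^ i) x = y" if "x \<in> X" "y \<in> X" for x y
  proof -
    from that ex obtain i j where ij: "i < n" "j < n" "x = h i" "y = h j" by metis
    have "(\<pi> ^^ (n - i + j)) x = y" using ij by (simp add: pow)
    then show ?thesis by blast
  qed
  ultimately have "cyclic_perm \<pi> X" unfolding cyclic_perm_def by blast
  then show ?thesis by (rule that)
qed

text \<open>A choice that depends on the set alone. No compatibility between different sets is asked
  for: equivariance will come from applying it to a set that the group action does not
  change.\<close>

definition rotation :: "'v set \<Rightarrow> 'v \<Rightarrow> 'v"
  where "rotation X = (SOME \<pi>. cyclic_perm \<pi> X)"

lemma cyclic_perm_rotation: "finite X \<Longrightarrow> cyclic_perm (rotation X) X"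
  unfolding rotation_def by (metis ex_cyclic_perm someI_ex)

section \<open>Percolation clusters on Cayley graphs\<close>

lemma vertices_component_of:
  "vertices_of (component_of G v) = {u. Vertex v \<in> G \<and> (v, u) \<in> (adjacent G)\<^sup>*}"
  by (auto simp: vertices_of_def component_of_def Let_def)

lemma vertices_component_of_subset: "vertices_of (component_of G v) \<subseteq> vertices_of G"
proof
  fix u assume "u \<in> vertices_of (component_of G v)"
  then have "(v, u) \<in> (adjacent G)\<^sup>*" "Vertex v \<in> G" by (auto simp: vertices_component_of)
  then show "u \<in> vertices_of G"
    by (cases rule: rtranclE) (auto simp: adjacent_def vertices_of_def)
qed

lemma vertices_component_of_step:
  "a \<in> vertices_of (component_of G v) \<Longrightarrow> (a, b) \<in> adjacent G \<Longrightarrow> b \<in> vertices_of (component_of G v)"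
  unfolding vertices_component_of by (auto simp: adjacent_def intro: rtrancl.rtrancl_into_rtrancl)

lemma adjacent_component_of:
  "(a, b) \<in> adjacent (component_of G v) \<longleftrightarrow> (a, b) \<in> adjacent G \<and> a \<in> vertices_of (component_of G v)"
proof -
  let ?C = "vertices_of (component_of G v)"
  have "Vertex c \<in> component_of G v \<longleftrightarrow> c \<in> ?C" for c
    by (simp add: vertices_of_def)
  moreover have "Edge e \<in> component_of G v \<longleftrightarrow> Edge e \<in> G \<and> e \<subseteq> ?C" for e
    by (auto simp: vertices_of_def component_of_def Let_def)
  ultimately have "(a, b) \<in> adjacent (component_of G v) \<longleftrightarrow> (a, b) \<in> adjacent G \<and> a \<in> ?C \<and> b \<in> ?C"
    using vertices_component_of_subset[of G v] by (auto simp: adjacent_def vertices_of_def)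
  then show ?thesis using vertices_component_of_step[of a G v b] by blast
qed

lemma component_of_connected:
  assumes "u \<in> vertices_of (component_of G v)"
  shows "(v, u) \<in> (adjacent (component_of G v))\<^sup>*"
proof -
  have "(v, u) \<in> (adjacent G)\<^sup>*" "Vertex v \<in> G" using assms by (auto simp: vertices_component_of)
  then show ?thesis
  proof (induction rule: rtrancl_induct)
    case (step y z)
    then have "y \<in> vertices_of (component_of G v)" "(v, y) \<in> (adjacent (component_of G v))\<^sup>*"
      by (auto simp: vertices_component_of)
    with step(2) show ?case by (auto simp: adjacent_component_of intro: rtrancl.rtrancl_into_rtrancl)
  qed auto
qed

lemma sym_adjacent: "sym (adjacent G)"
  by (auto simp: adjacent_def sym_def insert_commute)

text \<open>Vertices of \<open>K\<^sub>0\<close> avoid \<open>S\<close>, so an edge of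
  \<open>G\<close> at such a vertex can be missing from \<open>K\<^sub>0\<close> only if the edge
  itself or its other end was deleted. This is the boundary condition that
  \<open>common_contour\<close> asks for.\<close>

lemma component_of_diff:
  assumes "K\<^sub>0 \<in> components (component_of G x - S)"
  obtains v where "vertices_of K\<^sub>0 \<subseteq> (adjacent K\<^sub>0)\<^sup>* `` {v}"
    and "vertices_of K\<^sub>0 \<subseteq> vertices_of (component_of G x)"
    and "adjacent K\<^sub>0 \<subseteq> adjacent G"
    and "\<And>a b. (a, b) \<in> adjacent G \<Longrightarrow> a \<in> vertices_of K\<^sub>0 \<Longrightarrow> Vertex b \<notin> S \<Longrightarrow> Edge {a, b} \<notin> S \<Longrightarrow>
      (a, b) \<in> adjacent K\<^sub>0"
proof -
  let ?K = "component_of G x"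
  obtain v where K0: "K\<^sub>0 = component_of (?K - S) v" using assms by (auto simp: components_def)
  have V: "vertices_of K\<^sub>0 \<subseteq> vertices_of (?K - S)"
    unfolding K0 by (rule vertices_component_of_subset)
  show ?thesis
  proof (rule that[of v])
    show "vertices_of K\<^sub>0 \<subseteq> (adjacent K\<^sub>0)\<^sup>* `` {v}" using component_of_connected K0 by auto
    show "vertices_of K\<^sub>0 \<subseteq> vertices_of ?K" using V by (auto simp: vertices_of_def)
    show "adjacent K\<^sub>0 \<subseteq> adjacent G"
    proof clarify
      fix a b assume "(a, b) \<in> adjacent K\<^sub>0"
      then have "(a, b) \<in> adjacent (?K - S)" by (simp add: K0 adjacent_component_of)
      then have "(a, b) \<in> adjacent ?K" by (auto simp: adjacent_def)
      then show "(a, b) \<in> adjacent G" by (simp add: adjacent_component_of)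
    qed
    fix a b assume ab: "(a, b) \<in> adjacent G" "a \<in> vertices_of K\<^sub>0" "Vertex b \<notin> S" "Edge {a, b} \<notin> S"
    with V have "(a, b) \<in> adjacent ?K" by (auto simp: adjacent_component_of vertices_of_def)
    moreover have "Vertex a \<notin> S" using V ab(2) by (auto simp: vertices_of_def)
    ultimately have "(a, b) \<in> adjacent (?K - S)" using ab by (auto simp: adjacent_def)
    with ab(2) show "(a, b) \<in> adjacent K\<^sub>0" by (simp add: K0 adjacent_component_of)
  qed
qed

lemma adjacent_subset_vertices: "adjacent G \<subseteq> vertices_of G \<times> vertices_of G"
  by (auto simp: adjacent_def vertices_of_def)

section \<open>Left Cayley graphs and the action by right multiplication\<close>

locale cayley = group \<Gamma> for \<Gamma> :: "('g, 'b) monoid_scheme" (structure) +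
  fixes A :: "'g set"
  assumes finite_gen: "finite A" and gen_carrier: "A \<subseteq> carrier \<Gamma>" and gen: "generate \<Gamma> A = carrier \<Gamma>"
begin

text \<open>All neighbours of \<open>x\<close> are of the form \<open>l \<otimes> x\<close> with
  \<open>l\<close> in this set. Its cardinality bounds the degrees and is the constant of
  \<open>mass_transport\<close>.\<close>

definition steps :: "'g set"
  where "steps = A \<union> m_inv \<Gamma> ` A"

lemma finite_steps: "finite steps"
  by (simp add: steps_def finite_gen)

lemma steps_carrier: "steps \<subseteq> carrier \<Gamma>"
  using gen_carrier by (auto simp: steps_def)

text \<open>Every element is a product of a finite word in the finite set
  \<open>steps\<close>.\<close>

lemma countable_carrier: "countable (carrier \<Gamma>)"
proof -
  have X: "foldr (\<otimes>) ws \<one> \<in> carrier \<Gamma>" if "ws \<in> lists steps" for ws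
    using that steps_carrier by (induction ws) auto
  have app: "foldr (\<otimes>) (us @ ws) \<one> = foldr (\<otimes>) us \<one> \<otimes> foldr (\<otimes>) ws \<one>"
    if "us \<in> lists steps" "ws \<in> lists steps" for us ws
    using that(1) by (induction us) (use X[OF that(2)] X steps_carrier in \<open>auto simp: m_assoc subset_iff\<close>)
  have "x \<in> (\<lambda>ws. foldr (\<otimes>) ws \<one>) ` lists steps" if "x \<in> generate \<Gamma> A" for x
    using that
  proof (induction rule: generate.induct)
    case one show ?case by (rule image_eqI[of _ _ "[]"]) auto
  next
    case (incl h) then show ?case
      using gen_carrier by (intro image_eqI[of _ _ "[h]"]) (auto simp: steps_def)
  next
    case (inv h) then show ?case
      using gen_carrier by (intro image_eqI[of _ _ "[inv h]"]) (auto simp: steps_def)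
  next
    case (eng h1 h2)
    then obtain us ws where "us \<in> lists steps" "ws \<in> lists steps" "h1 = foldr (\<otimes>) us \<one>" "h2 = foldr (\<otimes>) ws \<one>"
      by auto
    with app show ?case by (intro image_eqI[of _ _ "us @ ws"]) auto
  qed
  then have "carrier \<Gamma> \<subseteq> (\<lambda>ws. foldr (\<otimes>) ws \<one>) ` lists steps" using gen by auto
  moreover have "countable (lists steps)" using finite_steps by (simp add: countable_finite)
  ultimately show ?thesis by (meson countable_image countable_subset)
qed

abbreviation "va \<equiv> vertex_act \<Gamma>"
abbreviation "sa \<equiv> site_act \<Gamma>"
abbreviation "edges \<equiv> cayley_edges \<Gamma> A"
abbreviation "sites \<equiv> cayley_sites \<Gamma> A"

lemma va_closed [simp]: "g \<in> carrier \<Gamma> \<Longrightarrow> x \<in> carrier \<Gamma> \<Longrightarrow> va g x \<in> carrier \<Gamma>"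
  by (simp add: vertex_act_def)

lemma va_inv [simp]:
  assumes "g \<in> carrier \<Gamma>" "x \<in> carrier \<Gamma>"
  shows "va (inv g) (va g x) = x" "va g (va (inv g) x) = x"
  using assms by (simp_all add: vertex_act_def m_assoc)

lemma va_mult: "g \<in> carrier \<Gamma> \<Longrightarrow> l \<in> carrier \<Gamma> \<Longrightarrow> x \<in> carrier \<Gamma> \<Longrightarrow> va g (l \<otimes> x) = l \<otimes> va g x"
  by (simp add: vertex_act_def m_assoc)

lemma va_inj: "g \<in> carrier \<Gamma> \<Longrightarrow> x \<in> carrier \<Gamma> \<Longrightarrow> y \<in> carrier \<Gamma> \<Longrightarrow> va g x = va g y \<longleftrightarrow> x = y"
  by (metis va_inv(1))

lemma Edge_in_edges_carrier: "Edge e \<in> edges \<Longrightarrow> e \<subseteq> carrier \<Gamma>"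
  using gen_carrier by (auto simp: cayley_edges_def)

lemma Edge_in_edgesD:
  assumes "Edge {a, b} \<in> edges"
  shows "a \<in> carrier \<Gamma>" "b \<in> carrier \<Gamma>" "a \<noteq> b" "\<exists>l\<in>steps. b = l \<otimes> a" "\<exists>l\<in>steps. a = l \<otimes> b"
proof -
  from assms obtain x l where xl: "{a, b} = {x, l \<otimes> x}" "x \<in> carrier \<Gamma>" "l \<in> A" "l \<otimes> x \<noteq> x"
    by (auto simp: cayley_edges_def)
  then have l: "l \<in> carrier \<Gamma>" using gen_carrier by auto
  have "x = inv l \<otimes> (l \<otimes> x)" using l xl by (simp add: m_assoc[symmetric])
  with xl l show "a \<in> carrier \<Gamma>" "b \<in> carrier \<Gamma>" "a \<noteq> b" "\<exists>l\<in>steps. b = l \<otimes> a" "\<exists>l\<in>steps. a = l \<otimes> b"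
    by (auto simp: doubleton_eq_iff steps_def)
qed

lemma vertex_in_sites [simp]: "Vertex v \<in> sites \<longleftrightarrow> v \<in> carrier \<Gamma>"
  by (auto simp: cayley_sites_def cayley_vertices_def cayley_edges_def)

lemma edge_in_sites [simp]: "Edge e \<in> sites \<longleftrightarrow> Edge e \<in> edges"
  by (auto simp: cayley_sites_def cayley_vertices_def)

lemma sa_vertices: "g \<in> carrier \<Gamma> \<Longrightarrow> s \<in> cayley_vertices \<Gamma> \<Longrightarrow> sa g s \<in> cayley_vertices \<Gamma>"
  by (auto simp: cayley_vertices_def)

lemma sa_edges: assumes "g \<in> carrier \<Gamma>" "s \<in> edges" shows "sa g s \<in> edges"
proof -
  from assms obtain x l where xl: "s = Edge {x, l \<otimes> x}" "x \<in> carrier \<Gamma>" "l \<in> A" "l \<otimes> x \<noteq> x"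
    by (auto simp: cayley_edges_def)
  then have l: "l \<in> carrier \<Gamma>" using gen_carrier by auto
  have "sa g s = Edge {va g x, l \<otimes> va g x}" using xl assms l by (simp add: va_mult)
  moreover have "l \<otimes> va g x \<noteq> va g x" using xl l assms by (simp add: va_inj flip: va_mult)
  ultimately show ?thesis
    unfolding cayley_edges_def using xl(2,3) assms(1) va_closed[of g x] by blast
qed

lemma sa_sites: "g \<in> carrier \<Gamma> \<Longrightarrow> s \<in> sites \<Longrightarrow> sa g s \<in> sites"
  using sa_vertices sa_edges by (auto simp: cayley_sites_def)

lemma sa_inv [simp]:
  assumes "g \<in> carrier \<Gamma>" "s \<in> sites"
  shows "sa (inv g) (sa g s) = s" "sa g (sa (inv g) s) = s"
proof -
  have "(\<lambda>x. va (inv g) (va g x)) ` e = e \<and> (\<lambda>x. va g (va (inv g) x)) ` e = e" if "e \<subseteq> carrier \<Gamma>" for e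
    using that assms(1) by (force simp: subset_iff)
  with assms show "sa (inv g) (sa g s) = s" "sa g (sa (inv g) s) = s"
    by (cases s; auto simp: image_image dest!: Edge_in_edges_carrier)+
qed

lemma countable_sites: "countable sites"
proof -
  have "edges \<subseteq> (\<lambda>(x, l). Edge {x, l \<otimes> x}) ` (carrier \<Gamma> \<times> A)"
    by (auto simp: cayley_edges_def)
  then have "countable edges"
    using countable_carrier finite_gen by (meson countable_SIGMA countable_finite countable_image countable_subset)
  then show ?thesis using countable_carrier by (simp add: cayley_sites_def cayley_vertices_def)
qed

lemma labelling_act_apply:
  assumes "g \<in> carrier \<Gamma>" "\<And>h t. h \<in> carrier \<Gamma> \<Longrightarrow> t \<in> D \<Longrightarrow> sa h t \<in> D" "s \<in> D" "D \<subseteq> sites"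
  shows "labelling_act \<Gamma> D g \<eta> (sa g s) = \<eta> s"
  using assms by (auto simp: labelling_act_def subset_iff)

lemma labelling_act_inv:
  assumes "g \<in> carrier \<Gamma>" "\<And>h t. h \<in> carrier \<Gamma> \<Longrightarrow> t \<in> D \<Longrightarrow> sa h t \<in> D" "D \<subseteq> sites"
    and "\<eta> \<in> space (labellings D)"
  shows "labelling_act \<Gamma> D (inv g) (labelling_act \<Gamma> D g \<eta>) = \<eta>"
proof
  fix s
  show "labelling_act \<Gamma> D (inv g) (labelling_act \<Gamma> D g \<eta>) s = \<eta> s"
    using assms by (cases "s \<in> D") (auto simp: labelling_act_def labellings_def space_PiM subset_iff)
qed

text \<open>The rotation at \<open>q\<close> depends only on the generators leading to its neighbours, which makes it
  equivariant.\<close>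

definition turn :: "'g \<Rightarrow> 'g set \<Rightarrow> 'g \<Rightarrow> 'g"
  where "turn q N p = rotation ((\<lambda>r. r \<otimes> inv q) ` N) (p \<otimes> inv q) \<otimes> q"

lemma cyclic_perm_turn:
  assumes "q \<in> carrier \<Gamma>" "N \<subseteq> carrier \<Gamma>" "finite N"
  shows "cyclic_perm (turn q N) N"
proof -
  let ?X = "(\<lambda>r. r \<otimes> inv q) ` N"
  let ?\<rho> = "rotation ?X"
  have c: "inj_on ?\<rho> ?X" "\<And>x. x \<in> ?X \<Longrightarrow> ?\<rho> x \<in> ?X" "\<And>x y. x \<in> ?X \<Longrightarrow> y \<in> ?X \<Longrightarrow> \<exists>i. (?\<rho> ^^ i) x = y"
    using cyclic_perm_rotation[of ?X] assms(3) by (auto simp: cyclic_perm_def image_subset_iff)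
  have N: "r \<in> carrier \<Gamma>" if "r \<in> N" for r using that assms(2) by auto
  have canc: "r \<otimes> inv q \<otimes> q = r" if "r \<in> carrier \<Gamma>" for r
    using that assms(1) by (simp add: m_assoc)
  have X: "x \<otimes> q \<in> N" "x \<in> carrier \<Gamma>" "x \<otimes> q \<otimes> inv q = x" if "x \<in> ?X" for x
    using that N assms(1) by (auto simp: m_assoc)
  have pow: "(turn q N ^^ i) p = (?\<rho> ^^ i) (p \<otimes> inv q) \<otimes> q \<and> (?\<rho> ^^ i) (p \<otimes> inv q) \<in> ?X" if "p \<in> N" for i p
  proof (induction i)
    case 0 with that show ?case by (simp add: canc N)
  next
    case (Suc i) then show ?case by (auto simp: turn_def X c(2) simp del: image_iff)
  qed
  have "inj_on (turn q N) N"
  proof (rule inj_onI)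
    fix x y assume xy: "x \<in> N" "y \<in> N" "turn q N x = turn q N y"
    let ?x = "x \<otimes> inv q" and ?y = "y \<otimes> inv q"
    have i: "?x \<in> ?X" "?y \<in> ?X" using xy by auto
    have "?\<rho> ?x = ?\<rho> ?y" using xy(3) X[OF c(2)[OF i(1)]] X[OF c(2)[OF i(2)]] by (metis turn_def)
    then have "?x = ?y" using i c(1) by (auto dest: inj_onD)
    then show "x = y" by (metis canc N xy(1,2))
  qed
  moreover have "turn q N ` N \<subseteq> N" using pow[of _ 1] X by auto
  moreover have "\<exists>i. (turn q N ^^ i) x = y" if "x \<in> N" "y \<in> N" for x y
  proof -
    have "x \<otimes> inv q \<in> ?X" "y \<otimes> inv q \<in> ?X" using that by auto
    from c(3)[OF this] obtain i where "(?\<rho> ^^ i) (x \<otimes> inv q) = y \<otimes> inv q" by auto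
    then show ?thesis using pow[OF that(1), of i] canc N that by auto
  qed
  ultimately show ?thesis by (auto simp: cyclic_perm_def)
qed

lemma turn_act:
  assumes "g \<in> carrier \<Gamma>" "q \<in> carrier \<Gamma>" "N \<subseteq> carrier \<Gamma>" "p \<in> N" "finite N"
  shows "turn (va g q) (va g ` N) (va g p) = va g (turn q N p)"
proof -
  \<comment> \<open>The action multiplies on the right, so it does not change the quotient of two
    vertices. Both sides therefore use the same rotation.\<close>
  have diff: "va g r \<otimes> inv (va g q) = r \<otimes> inv q" if "r \<in> carrier \<Gamma>" for r
    using that assms(1,2) by (simp add: vertex_act_def inv_mult_group m_assoc) (simp add: m_assoc[symmetric])
  let ?X = "(\<lambda>r. r \<otimes> inv q) ` N"
  have "(\<lambda>r. r \<otimes> inv (va g q)) ` va g ` N = ?X"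
    using diff assms(3) by (force simp: image_image subset_iff)
  moreover have "rotation ?X (p \<otimes> inv q) \<in> ?X"
    using cyclic_perm_rotation[of ?X] assms by (auto simp: cyclic_perm_def image_subset_iff)
  then have "rotation ?X (p \<otimes> inv q) \<in> carrier \<Gamma>" using assms by auto
  ultimately show ?thesis using assms diff[of p] by (auto simp: turn_def va_mult)
qed

end

section \<open>Equivariance of the open graph, its forest and the walk along contours\<close>

locale cayley_percolation = cayley \<Gamma> A for \<Gamma> :: "('g, 'b) monoid_scheme" (structure) and A :: "'g set" +
  fixes W :: "'g site set"
  assumes W: "W \<subseteq> sites" and W_act: "\<And>g s. g \<in> carrier \<Gamma> \<Longrightarrow> s \<in> W \<Longrightarrow> sa g s \<in> W"
begin

definition adj :: "'g site set \<Rightarrow> ('g \<times> 'g) set"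
  where "adj \<omega> = adjacent (open_graph \<Gamma> A W \<omega>)"

definition msforest :: "('g site \<Rightarrow> real) \<Rightarrow> 'g site set \<Rightarrow> ('g \<times> 'g) set"
  where "msforest u \<omega> = msf (\<lambda>e. u (Edge e)) (adj \<omega>)"

definition walk :: "('g site \<Rightarrow> real) \<Rightarrow> 'g site set \<Rightarrow> nat \<Rightarrow> 'g \<times> 'g \<Rightarrow> 'g \<times> 'g"
  where "walk u \<omega> i = contour turn (msforest u \<omega>) ^^ i"

abbreviation "ea g \<equiv> map_prod (va g) (va g)"

lemma adjD:
  assumes "(a, b) \<in> adj \<omega>"
  shows "Edge {a, b} \<in> edges" "a \<in> carrier \<Gamma>" "b \<in> carrier \<Gamma>" "a \<noteq> b" "b \<in> (\<lambda>l. l \<otimes> a) ` steps" "a \<in> (\<lambda>l. l \<otimes> b) ` steps"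
proof -
  show "Edge {a, b} \<in> edges" using assms by (auto simp: adj_def adjacent_def open_graph_def)
  from Edge_in_edgesD[OF this] show "a \<in> carrier \<Gamma>" "b \<in> carrier \<Gamma>" "a \<noteq> b" "b \<in> (\<lambda>l. l \<otimes> a) ` steps" "a \<in> (\<lambda>l. l \<otimes> b) ` steps"
    by auto
qed

lemma sym_adj: "sym (adj \<omega>)"
  by (auto simp: adj_def adjacent_def sym_def insert_commute)

lemma finite_adj: "finite (adj \<omega> `` {v})"
  by (rule finite_subset[of _ "(\<lambda>l. l \<otimes> v) ` steps"]) (use adjD(5) finite_steps in auto)

lemma adj_carrier: "adj \<omega> \<subseteq> carrier \<Gamma> \<times> carrier \<Gamma>"
  using adjD by auto

lemma msforest_subset: "msforest u \<omega> \<subseteq> adj \<omega>"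
  by (simp add: msforest_def msf_subset)

lemma contour_graph_msforest: "contour_graph turn (msforest u \<omega>)"
proof
  show "sym (msforest u \<omega>)" by (simp add: msforest_def sym_msf sym_adj)
  fix p q assume pq: "(p, q) \<in> msforest u \<omega>"
  have "msforest u \<omega> `` {q} \<subseteq> adj \<omega> `` {q}" using msforest_subset by auto
  moreover have "adj \<omega> `` {q} \<subseteq> carrier \<Gamma>" using adj_carrier by auto
  ultimately show "cyclic_perm (turn q (msforest u \<omega> `` {q})) (msforest u \<omega> `` {q})"
    using finite_adj[of \<omega> q] adjD(3)[of p q \<omega>] pq msforest_subset[of u \<omega>]
    by (intro cyclic_perm_turn) (auto intro: finite_subset)
qed

lemma subset_act_inv:
  assumes "g \<in> carrier \<Gamma>" "\<omega> \<subseteq> W"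
  shows "subset_act \<Gamma> (inv g) (subset_act \<Gamma> g \<omega>) = \<omega>"
proof -
  have "sa (inv g) (sa g s) = s" if "s \<in> \<omega>" for s using that assms W by auto
  then show ?thesis by (force simp: subset_act_def image_image)
qed

lemma subset_act_subset: "g \<in> carrier \<Gamma> \<Longrightarrow> \<omega> \<subseteq> W \<Longrightarrow> subset_act \<Gamma> g \<omega> \<subseteq> W"
  using W_act by (auto simp: subset_act_def)

lemma open_graph_act:
  assumes "g \<in> carrier \<Gamma>" "\<omega> \<subseteq> W" "s \<in> open_graph \<Gamma> A W \<omega>"
  shows "sa g s \<in> open_graph \<Gamma> A W (subset_act \<Gamma> g \<omega>)"
proof -
  have s: "s \<in> sites" "s \<in> W \<Longrightarrow> s \<in> \<omega>" using assms(3) by (auto simp: open_graph_def)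
  have "sa g s \<in> subset_act \<Gamma> g \<omega>" if "sa g s \<in> W"
  proof -
    have "sa (inv g) (sa g s) \<in> W" using that assms(1) by (intro W_act[of "inv g"]) auto
    then have "s \<in> W" using s assms(1) by simp
    then show ?thesis using s assms(1) by (auto simp: subset_act_def)
  qed
  with s assms(1) show ?thesis by (auto simp: open_graph_def sa_sites)
qed

lemma adj_act:
  assumes "g \<in> carrier \<Gamma>" "\<omega> \<subseteq> W" "(a, b) \<in> adj \<omega>"
  shows "(va g a, va g b) \<in> adj (subset_act \<Gamma> g \<omega>)"
  using open_graph_act[OF assms(1,2), of "Vertex a"] open_graph_act[OF assms(1,2), of "Vertex b"]
    open_graph_act[OF assms(1,2), of "Edge {a, b}"] assms(3)
  by (auto simp: adj_def adjacent_def)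

abbreviation "la g u \<equiv> labelling_act \<Gamma> edges g (u :: 'g site \<Rightarrow> real)"

lemma la_Edge:
  assumes "g \<in> carrier \<Gamma>" "Edge {a, b} \<in> edges"
  shows "la g u (Edge {va g a, va g b}) = u (Edge {a, b})"
  using labelling_act_apply[OF assms(1) sa_edges assms(2), of u] by (auto simp: cayley_sites_def)

text \<open>Labels travel with their edges. A path of lighter edges after the action would be
  carried back by \<open>inv g\<close> to such a path before it.\<close>

lemma msforest_act:
  assumes g: "g \<in> carrier \<Gamma>" and \<omega>: "\<omega> \<subseteq> W" and ab: "(a, b) \<in> msforest u \<omega>"
  shows "(va g a, va g b) \<in> msforest (la g u) (subset_act \<Gamma> g \<omega>)"
proof -
  let ?U = "\<lambda>e. u (Edge e)" and ?U' = "\<lambda>e. la g u (Edge e)" and ?\<omega> = "subset_act \<Gamma> g \<omega>"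
  have adj: "(a, b) \<in> adj \<omega>" using ab msforest_subset by auto
  note ab' = adjD[OF adj]
  have lab: "?U' {va g a, va g b} = ?U {a, b}" using la_Edge[OF g ab'(1)] .
  have "(va g a, va g b) \<notin> (below ?U' (adj ?\<omega>) (?U {a, b}))\<^sup>*"
  proof
    assume "(va g a, va g b) \<in> (below ?U' (adj ?\<omega>) (?U {a, b}))\<^sup>*"
    then have "(va (inv g) (va g a), va (inv g) (va g b)) \<in> (below ?U (adj \<omega>) (?U {a, b}))\<^sup>*"
    proof (rule rtrancl_image[rotated])
      fix c d assume cd: "(c, d) \<in> below ?U' (adj ?\<omega>) (?U {a, b})"
      then have adj': "(c, d) \<in> adj ?\<omega>" by (auto simp: below_def)
      let ?c = "va (inv g) c" and ?d = "va (inv g) d"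
      have "(?c, ?d) \<in> adj \<omega>"
        using adj_act[OF inv_closed[OF g] subset_act_subset[OF g \<omega>] adj'] subset_act_inv[OF g \<omega>] by simp
      moreover from la_Edge[OF g adjD(1)[OF this], of u] have "?U' {c, d} = ?U {?c, ?d}"
        using adjD(2,3)[OF adj'] g by simp
      ultimately show "(?c, ?d) \<in> below ?U (adj \<omega>) (?U {a, b})"
        using cd by (simp add: below_def)
    qed
    then show False using ab ab' g by (simp add: msforest_def msf_def)
  qed
  with adj_act[OF g \<omega> adj] lab show ?thesis by (simp add: msforest_def msf_def)
qed

lemma msforest_act_iff:
  assumes g: "g \<in> carrier \<Gamma>" and \<omega>: "\<omega> \<subseteq> W" and u: "u \<in> space (labellings edges)"
    and "a \<in> carrier \<Gamma>" "b \<in> carrier \<Gamma>"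
  shows "(va g a, va g b) \<in> msforest (la g u) (subset_act \<Gamma> g \<omega>) \<longleftrightarrow> (a, b) \<in> msforest u \<omega>"
proof
  assume "(va g a, va g b) \<in> msforest (la g u) (subset_act \<Gamma> g \<omega>)"
  then have "(va (inv g) (va g a), va (inv g) (va g b)) \<in>
      msforest (la (inv g) (la g u)) (subset_act \<Gamma> (inv g) (subset_act \<Gamma> g \<omega>))"
    using inv_closed[OF g] subset_act_subset[OF g \<omega>] by (rule msforest_act[rotated 2])
  moreover have "la (inv g) (la g u) = u"
    using g sa_edges _ u by (rule labelling_act_inv) (auto simp: cayley_sites_def)
  ultimately show "(a, b) \<in> msforest u \<omega>" using assms by (simp add: subset_act_inv)
qed (rule msforest_act[OF g \<omega>])

lemma contour_act:
  assumes g: "g \<in> carrier \<Gamma>" and \<omega>: "\<omega> \<subseteq> W" and u: "u \<in> space (labellings edges)"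
    and e: "e \<in> msforest u \<omega>"
  shows "contour turn (msforest (la g u) (subset_act \<Gamma> g \<omega>)) (ea g e) = ea g (contour turn (msforest u \<omega>) e)"
proof -
  obtain p q where pq: "e = (p, q)" by (cases e)
  have adj: "(p, q) \<in> adj \<omega>" using e msforest_subset by (auto simp: pq)
  let ?F = "msforest u \<omega>" and ?F' = "msforest (la g u) (subset_act \<Gamma> g \<omega>)"
  have F: "?F `` {q} \<subseteq> carrier \<Gamma>" "finite (?F `` {q})"
    using msforest_subset[of u \<omega>] adj_carrier[of \<omega>] finite_subset[OF _ finite_adj, of "?F `` {q}" \<omega> q] by auto
  have "?F' `` {va g q} = va g ` (?F `` {q})"
  proof safe
    fix r assume r: "(va g q, r) \<in> ?F'"
    then have rc: "r \<in> carrier \<Gamma>" using msforest_subset adj_carrier by blast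
    define r' where "r' = va (inv g) r"
    have "r = va g r'" "r' \<in> carrier \<Gamma>" using rc g by (auto simp: r'_def)
    with r show "r \<in> va g ` (?F `` {q})"
      using msforest_act_iff[OF g \<omega> u] adjD(3)[OF adj] by auto
  qed (use msforest_act[OF g \<omega>] in auto)
  moreover have "p \<in> ?F `` {q}"
    using e contour_graph.flip[OF contour_graph_msforest] by (auto simp: pq)
  ultimately show ?thesis
    using turn_act[OF g adjD(3)[OF adj] F(1) _ F(2)] by (simp add: contour_def pq)
qed

lemma walk_in: "e \<in> msforest u \<omega> \<Longrightarrow> walk u \<omega> i e \<in> msforest u \<omega>"
  unfolding walk_def by (rule contour_graph.contour_pow_in[OF contour_graph_msforest])

lemma walk_act:
  assumes g: "g \<in> carrier \<Gamma>" and \<omega>: "\<omega> \<subseteq> W" and u: "u \<in> space (labellings edges)"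
    and e: "e \<in> msforest u \<omega>"
  shows "walk (la g u) (subset_act \<Gamma> g \<omega>) i (ea g e) = ea g (walk u \<omega> i e)"
proof (induction i)
  case (Suc i)
  then show ?case using contour_act[OF g \<omega> u walk_in[OF e, of i]] by (simp add: walk_def)
qed (simp add: walk_def)

text \<open>The set \<open>Z\<close> for \<open>common_contour\<close>: a vertex outside
  \<open>S\<close> can lose an edge by the removal of \<open>S\<close> only if the edge or its other
  end belongs to \<open>S\<close>.\<close>

definition rim :: "'g site set \<Rightarrow> 'g set"
  where "rim S = {a. \<exists>b. Edge {a, b} \<in> edges \<and> (Vertex b \<in> S \<or> Edge {a, b} \<in> S)}"

lemma finite_rim: assumes "finite S" shows "finite (rim S)"
proof -
  let ?V = "{b. Vertex b \<in> S}" and ?E = "{e. Edge e \<in> S \<inter> edges}"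
  have "finite (Vertex -` S)" "finite (Edge -` (S \<inter> edges))"
    using assms by (auto intro!: finite_vimageI simp: inj_on_def)
  then have fin: "finite ?V" "finite ?E" by (simp_all add: vimage_def)
  have "finite e" if "e \<in> ?E" for e using that by (auto simp: cayley_edges_def)
  then have "finite ((\<Union>b\<in>?V. (\<lambda>l. l \<otimes> b) ` steps) \<union> \<Union>?E)"
    using fin finite_steps by blast
  moreover have "rim S \<subseteq> (\<Union>b\<in>?V. (\<lambda>l. l \<otimes> b) ` steps) \<union> \<Union>?E"
  proof
    fix a assume "a \<in> rim S"
    then obtain b where b: "Edge {a, b} \<in> edges" "Vertex b \<in> S \<or> Edge {a, b} \<in> S"
      by (auto simp: rim_def)
    with Edge_in_edgesD(5)[OF b(1)] show "a \<in> (\<Union>b\<in>?V. (\<lambda>l. l \<otimes> b) ` steps) \<union> \<Union>?E" by blast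
  qed
  ultimately show ?thesis by (rule rev_finite_subset)
qed

text \<open>Apply \<open>common_contour\<close> to the two open graphs, which both contain
  \<open>K\<^sub>0\<close>, with the adjacency of \<open>K\<^sub>0\<close> as \<open>H\<close>. The
  walk stays in \<open>K\<^sub>0\<close> and therefore visits vertices of both clusters
  only.\<close>

lemma common_walk:
  assumes inj: "inj_on u edges" and S: "finite S"
    and K: "K\<^sub>0 \<in> components (cluster \<Gamma> A W \<omega> x - S)" and K': "K\<^sub>0 \<in> components (cluster \<Gamma> A W \<omega>' x' - S)"
    and inf: "infinite (vertices_of K\<^sub>0)"
  obtains e p where "e \<in> msforest u \<omega>" "e \<in> msforest u \<omega>'"
    "\<And>i. walk u \<omega> i e = p i" "\<And>i. walk u \<omega>' i e = p i"
    "\<And>i. snd (p i) \<in> vertices_of (cluster \<Gamma> A W \<omega> x)" "\<And>i. snd (p i) \<in> vertices_of (cluster \<Gamma> A W \<omega>' x')"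
    "\<And>Y. finite Y \<Longrightarrow> \<forall>\<^sub>F i in sequentially. snd (p i) \<notin> Y"
proof -
  let ?H = "adjacent K\<^sub>0" and ?V = "vertices_of K\<^sub>0" and ?U = "\<lambda>e. u (Edge e)"
  obtain v where v: "?V \<subseteq> ?H\<^sup>* `` {v}" "?V \<subseteq> vertices_of (cluster \<Gamma> A W \<omega> x)" "?H \<subseteq> adj \<omega>"
    "\<And>a b. (a, b) \<in> adj \<omega> \<Longrightarrow> a \<in> ?V \<Longrightarrow> Vertex b \<notin> S \<Longrightarrow> Edge {a, b} \<notin> S \<Longrightarrow> (a, b) \<in> ?H"
    by (rule component_of_diff[OF K[unfolded cluster_def], folded cluster_def adj_def]) blast
  obtain v' where v': "?V \<subseteq> vertices_of (cluster \<Gamma> A W \<omega>' x')" "?H \<subseteq> adj \<omega>'"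
    "\<And>a b. (a, b) \<in> adj \<omega>' \<Longrightarrow> a \<in> ?V \<Longrightarrow> Vertex b \<notin> S \<Longrightarrow> Edge {a, b} \<notin> S \<Longrightarrow> (a, b) \<in> ?H"
    by (rule component_of_diff[OF K'[unfolded cluster_def], folded cluster_def adj_def]) blast
  have dist: "distinct_labels ?U (adj \<omega>)" for \<omega>
    unfolding distinct_labels_def using inj adjD(1)[of _ _ \<omega>] by (auto dest!: inj_onD[OF inj])
  have bd: "(a, b) \<in> ?H" if "R \<in> {adj \<omega>, adj \<omega>'}" "(a, b) \<in> R" "a \<in> ?V - rim S" for R a b
    using that v(4)[of a b] v'(3)[of a b] adjD(1)[of a b] by (auto simp: rim_def)
  have infH: "infinite (?H\<^sup>* `` {v})" using v(1) inf finite_subset by auto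
  obtain e g where eg: "\<And>R i. R \<in> {adj \<omega>, adj \<omega>'} \<Longrightarrow> (contour turn (msf ?U R) ^^ i) e = g i"
    "\<And>R. R \<in> {adj \<omega>, adj \<omega>'} \<Longrightarrow> e \<in> msf ?U R" "\<And>i. g i \<in> ?H"
    "\<And>Y. finite Y \<Longrightarrow> \<forall>\<^sub>F i in sequentially. snd (g i) \<notin> Y"
  proof (rule common_contour[of "{adj \<omega>, adj \<omega>'}" ?U "carrier \<Gamma>" ?H ?V "rim S" v turn], goal_cases)
    case (1 R)
    then show ?case using v(3) v'(2) sym_adj dist adj_carrier finite_adj by blast
  next
    case 5 show ?case by (rule adjacent_subset_vertices)
  next
    case (9 q N) from 9(2-) show ?case by (rule cyclic_perm_turn)
  next
    case (10 e g) from 10(2-) show ?case by (rule 10(1))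
  qed (use sym_adjacent adjacent_subset_vertices finite_rim[OF S] infH bd in auto)
  have V: "snd (g i) \<in> ?V" for i
    using eg(3)[of i] adjacent_subset_vertices[of K\<^sub>0] by (cases "g i") auto
  show ?thesis
    by (rule that[of e g]) (use eg V v(2) v'(1) in \<open>auto simp: msforest_def walk_def\<close>)
qed

end

section \<open>Measurability and random labels\<close>

lemma pred_countable_Bex:
  assumes "countable X" "\<And>x. x \<in> X \<Longrightarrow> Measurable.pred M (P x)"
  shows "Measurable.pred M (\<lambda>z. \<exists>x\<in>X. P x z)"
  unfolding pred_def by (rule sets.sets_Collect_countable_Ex'[OF _ assms(1)]) (use assms(2) in \<open>simp add: pred_def\<close>)

text \<open>Reachability is a countable union over the length of a path, and each further edge adds
  a countable union over the last intermediate vertex.\<close>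

lemma pred_rtrancl:
  assumes X: "countable X" "\<And>z. z \<in> space M \<Longrightarrow> R z \<subseteq> X \<times> X"
    and R: "\<And>a b. a \<in> X \<Longrightarrow> b \<in> X \<Longrightarrow> Measurable.pred M (\<lambda>z. (a, b) \<in> R z)"
    and ab: "a \<in> X" "b \<in> X"
  shows "Measurable.pred M (\<lambda>z. (a, b) \<in> (R z)\<^sup>*)"
proof -
  have "Measurable.pred M (\<lambda>z. (a, b) \<in> R z ^^ n)" for n
    using ab(2)
  proof (induction n arbitrary: b)
    case (Suc n)
    have "Measurable.pred M (\<lambda>z. \<exists>c\<in>X. (a, c) \<in> R z ^^ n \<and> (c, b) \<in> R z)"
      using Suc R X(1) by (intro pred_countable_Bex pred_intros_logic) auto
    moreover have "(a, b) \<in> R z ^^ Suc n \<longleftrightarrow> (\<exists>c\<in>X. (a, c) \<in> R z ^^ n \<and> (c, b) \<in> R z)" if "z \<in> space M" for z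
      using X(2)[OF that] by auto
    ultimately show ?case by (subst measurable_cong) auto
  qed simp
  then show ?thesis by (simp add: rtrancl_power)
qed

lemma space_subset_space: "space (subset_space W) = Pow W"
  unfolding subset_space_def by (rule space_measure_of) auto

lemma sets_subset_space: "sets (subset_space W) = sigma_sets (Pow W) ((\<lambda>s. {\<omega> \<in> Pow W. s \<in> \<omega>}) ` W)"
  unfolding subset_space_def by (rule sets_measure_of) auto

lemma pred_mem_subset_space:
  assumes [measurable]: "\<omega> \<in> N \<rightarrow>\<^sub>M subset_space W" and "s \<in> W"
  shows "Measurable.pred N (\<lambda>z. s \<in> \<omega> z)"
proof -
  have "{\<omega> \<in> space (subset_space W). s \<in> \<omega>} \<in> sets (subset_space W)"
    unfolding sets_subset_space space_subset_space using assms(2) by (intro sigma_sets.Basic) auto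
  then have [measurable]: "Measurable.pred (subset_space W) (\<lambda>\<omega>. s \<in> \<omega>)" by (simp add: pred_def)
  show ?thesis by measurable
qed

lemma measurable_subset_space:
  assumes "\<And>z. z \<in> space N \<Longrightarrow> \<omega> z \<subseteq> W" "\<And>s. s \<in> W \<Longrightarrow> Measurable.pred N (\<lambda>z. s \<in> \<omega> z)"
  shows "\<omega> \<in> N \<rightarrow>\<^sub>M subset_space W"
  unfolding subset_space_def
proof (rule measurable_measure_of)
  fix Y assume "Y \<in> (\<lambda>s. {\<omega> \<in> Pow W. s \<in> \<omega>}) ` W"
  then obtain s where s: "s \<in> W" "Y = {\<omega> \<in> Pow W. s \<in> \<omega>}" by auto
  then have "\<omega> -` Y \<inter> space N = {z \<in> space N. s \<in> \<omega> z}" using assms(1) by auto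
  then show "\<omega> -` Y \<inter> space N \<in> sets N" using assms(2)[OF s(1)] by (simp add: pred_def)
qed (use assms(1) in auto)

lemma measurable_labelling_apply:
  assumes "\<eta> \<in> N \<rightarrow>\<^sub>M labellings D" "s \<in> D"
  shows "(\<lambda>z. \<eta> z s) \<in> borel_measurable N"
  using measurable_compose[OF assms(1)[unfolded labellings_def] measurable_component_singleton[OF assms(2)]] .

context cayley
begin

lemma measurable_labelling_act:
  assumes "\<And>h s. h \<in> carrier \<Gamma> \<Longrightarrow> s \<in> D \<Longrightarrow> sa h s \<in> D" "g \<in> carrier \<Gamma>"
  shows "labelling_act \<Gamma> D g \<in> labellings D \<rightarrow>\<^sub>M labellings D"
  unfolding labelling_act_def labellings_def
  by (intro measurable_restrict measurable_component_singleton assms inv_closed)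

end

context cayley_percolation
begin

lemma measurable_subset_act:
  assumes g: "g \<in> carrier \<Gamma>"
  shows "subset_act \<Gamma> g \<in> subset_space W \<rightarrow>\<^sub>M subset_space W"
proof (rule measurable_subset_space)
  show "subset_act \<Gamma> g \<omega> \<subseteq> W" if "\<omega> \<in> space (subset_space W)" for \<omega>
    using that subset_act_subset[OF g] by (simp add: space_subset_space)
  fix s assume s: "s \<in> W"
  have "Measurable.pred (subset_space W) (\<lambda>\<omega>. sa (inv g) s \<in> \<omega>)"
    using g s W_act by (intro pred_mem_subset_space[OF measurable_ident_sets[OF refl]]) auto
  moreover have "s \<in> subset_act \<Gamma> g \<omega> \<longleftrightarrow> sa (inv g) s \<in> \<omega>" if "\<omega> \<in> space (subset_space W)" for \<omega>
    using that g s W sa_inv[OF g, of s] sa_inv[OF g] by (force simp: subset_act_def space_subset_space)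
  ultimately show "Measurable.pred (subset_space W) (\<lambda>\<omega>. s \<in> subset_act \<Gamma> g \<omega>)"
    by (subst measurable_cong) auto
qed

lemma pred_adj:
  assumes "\<omega> \<in> N \<rightarrow>\<^sub>M subset_space W"
  shows "Measurable.pred N (\<lambda>z. (a, b) \<in> adj (\<omega> z))"
proof -
  have "Measurable.pred N (\<lambda>z. s \<in> open_graph \<Gamma> A W (\<omega> z))" for s
    using pred_mem_subset_space[OF assms, of s] by (cases "s \<in> W") (auto simp: open_graph_def)
  then show ?thesis unfolding adj_def adjacent_def by simp
qed

lemma pred_msforest:
  assumes \<omega>: "\<omega> \<in> N \<rightarrow>\<^sub>M subset_space W" and u: "u \<in> N \<rightarrow>\<^sub>M labellings edges"
  shows "Measurable.pred N (\<lambda>z. (a, b) \<in> msforest (u z) (\<omega> z))"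
proof (cases "Edge {a, b} \<in> edges")
  case False
  then have "(a, b) \<notin> msforest (u z) (\<omega> z)" for z
    using adjD(1) msforest_subset by blast
  then show ?thesis by simp
next
  case True
  let ?R = "\<lambda>z. below (\<lambda>e. u z (Edge e)) (adj (\<omega> z)) (u z (Edge {a, b}))"
  have "Measurable.pred N (\<lambda>z. (c, d) \<in> ?R z)" for c d
  proof (cases "Edge {c, d} \<in> edges")
    case False
    then have "(c, d) \<notin> ?R z" for z using adjD(1) by (auto simp: below_def)
    then show ?thesis by simp
  next
    case cd: True
    note [measurable] = pred_adj[OF \<omega>] measurable_labelling_apply[OF u True] measurable_labelling_apply[OF u cd]
    show ?thesis unfolding below_def by simp
  qed
  then have [measurable]: "Measurable.pred N (\<lambda>z. (a, b) \<in> (?R z)\<^sup>*)"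
    using Edge_in_edgesD(1,2)[OF True] adj_carrier
    by (intro pred_rtrancl[OF countable_carrier]) (auto simp: below_def)
  note [measurable] = pred_adj[OF \<omega>]
  show ?thesis unfolding msforest_def msf_def by simp
qed

text \<open>\<open>turn\<close> is built from an arbitrary choice, but it is evaluated only on
  subsets of the finite set of potential neighbours of \<open>q\<close>, so a finite case
  distinction over these subsets suffices.\<close>

lemma pred_contour:
  assumes \<omega>: "\<omega> \<in> N \<rightarrow>\<^sub>M subset_space W" and u: "u \<in> N \<rightarrow>\<^sub>M labellings edges"
  shows "Measurable.pred N (\<lambda>z. contour turn (msforest (u z) (\<omega> z)) e = e')"
proof -
  obtain p q where e: "e = (p, q)" by (cases e)
  let ?F = "\<lambda>z. msforest (u z) (\<omega> z)" and ?N = "(\<lambda>l. l \<otimes> q) ` steps"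
  note [measurable] = pred_msforest[OF \<omega> u]
  have fin: "finite ?N" using finite_steps by simp
  have sub: "?F z `` {q} \<subseteq> ?N" for z
    using msforest_subset[of "u z" "\<omega> z"] adjD(5) by auto
  have "?F z `` {q} = Y \<longleftrightarrow> (\<forall>r\<in>?N. (q, r) \<in> ?F z \<longleftrightarrow> r \<in> Y)" if "Y \<in> Pow ?N" for z Y
    using that sub[of z] by auto
  then have "contour turn (?F z) e = e' \<longleftrightarrow>
      (\<exists>Y\<in>Pow ?N. (\<forall>r\<in>?N. (q, r) \<in> ?F z \<longleftrightarrow> r \<in> Y) \<and> (q, turn q Y p) = e')" for z
    using sub[of z] by (auto simp: contour_def e) (metis PowI)+
  moreover have "Measurable.pred N (\<lambda>z. \<exists>Y\<in>Pow ?N. (\<forall>r\<in>?N. (q, r) \<in> ?F z \<longleftrightarrow> r \<in> Y) \<and> (q, turn q Y p) = e')"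
    using fin by (intro pred_intros_finite pred_intros_logic) auto
  ultimately show ?thesis by simp
qed

text \<open>Membership of \<open>e\<close> in the forest is part of the event because it keeps the
  walk on pairs of group elements. The induction can then sum over countably many values of the
  previous edge.\<close>

lemma pred_walk:
  assumes \<omega>: "\<omega> \<in> N \<rightarrow>\<^sub>M subset_space W" and u: "u \<in> N \<rightarrow>\<^sub>M labellings edges"
  shows "Measurable.pred N (\<lambda>z. e \<in> msforest (u z) (\<omega> z) \<and> walk (u z) (\<omega> z) i e = e')"
proof (induction i arbitrary: e')
  case 0
  show ?case using pred_msforest[OF assms, of "fst e" "snd e"] by (auto simp: walk_def)
next
  case (Suc i)
  let ?F = "\<lambda>z. msforest (u z) (\<omega> z)" and ?w = "\<lambda>z. walk (u z) (\<omega> z)"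
  have "Measurable.pred N (\<lambda>z. (e \<in> ?F z \<and> ?w z i e = d) \<and> contour turn (?F z) d = e')" for d
    using Suc pred_contour[OF assms] by (rule pred_intros_logic(3))
  then have "Measurable.pred N (\<lambda>z. \<exists>d\<in>carrier \<Gamma> \<times> carrier \<Gamma>.
      (e \<in> ?F z \<and> ?w z i e = d) \<and> contour turn (?F z) d = e')"
    using countable_carrier by (intro pred_countable_Bex) auto
  moreover have "e \<in> ?F z \<and> ?w z (Suc i) e = e' \<longleftrightarrow>
      (\<exists>d\<in>carrier \<Gamma> \<times> carrier \<Gamma>. (e \<in> ?F z \<and> ?w z i e = d) \<and> contour turn (?F z) d = e')" for z
    using walk_in[of e "u z" "\<omega> z" i] msforest_subset[of "u z" "\<omega> z"] adj_carrier[of "\<omega> z"]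
    by (auto simp: walk_def)
  ultimately show ?case by simp
qed

end

section \<open>Independent uniform labels\<close>

definition label_measure :: "'s set \<Rightarrow> ('s \<Rightarrow> real) measure"
  where "label_measure I = (\<Pi>\<^sub>M i\<in>I. uniform_measure lborel {0..1})"

lemma prob_space_unit: "prob_space (uniform_measure lborel {0..1::real})"
  by (rule prob_space_uniform_measure) auto

lemma sets_label_measure: "sets (label_measure I) = sets (labellings I)"
  unfolding label_measure_def labellings_def by (rule sets_PiM_cong) auto

lemma prob_space_label_measure: "prob_space (label_measure I)"
  unfolding label_measure_def by (rule prob_space_PiM) (rule prob_space_unit)

text \<open>For every \<open>n\<close>, the event of equal labels is covered by \<open>n + 2\<close>
  events on which both labels lie in the same set \<open>X k\<close> of probability at most
  \<open>1 / n\<close>. By independence each of them has probability at most \<open>1 / n^2\<close>,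
  and the sum tends to 0.\<close>

lemma AE_label_neq:
  assumes st: "s \<in> I" "t \<in> I" "s \<noteq> t"
  shows "AE u in label_measure I. u s \<noteq> u t"
proof -
  let ?U = "uniform_measure lborel {0..1::real}"
  interpret U: prob_space ?U by (rule prob_space_unit)
  interpret product_prob_space "\<lambda>_. ?U" I by unfold_locales
  interpret Q: prob_space "label_measure I" by (rule prob_space_label_measure)
  note [measurable] = st(1,2)
  have eq: "{u \<in> space (label_measure I). u s = u t} \<in> sets (label_measure I)"
    unfolding label_measure_def by measurable
  define p where "p = Q.prob {u \<in> space (label_measure I). u s = u t}"
  have "p * real n ^ 2 \<le> real n + 2" if "n > 0" for n :: nat
  proof -
    \<comment> \<open>Index \<open>n\<close> is there for the label 1, which the half-open intervals
      before it miss. All larger indices give the null complement of the unit interval, of which the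
      cover below uses index \<open>n + 1\<close>.\<close>
    define X where "X k = (if k \<le> n then {real k / n ..< (real k + 1) / n} else - {0..1::real})" for k :: nat
    have X: "X k \<in> sets ?U" for k by (auto simp: X_def)
    have small: "U.prob (X k) \<le> 1 / n" for k
    proof (cases "k \<le> n")
      case True
      have "emeasure ?U (X k) \<le> emeasure lborel (X k)"
        using X by (subst emeasure_uniform_measure) (auto intro!: emeasure_mono simp: divide_ennreal_def)
      also have "\<dots> = ennreal (1 / n)" using True by (simp add: X_def divide_right_mono diff_divide_distrib[symmetric])
      finally show ?thesis by (simp add: U.emeasure_eq_measure)
    next
      case False
      then have "emeasure ?U (X k) = 0"
        by (subst emeasure_uniform_measure) (auto simp: X_def)
      then show ?thesis by (simp add: U.emeasure_eq_measure)
    qed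
    let ?B = "\<lambda>k. {u \<in> space (label_measure I). \<forall>i\<in>{s, t}. u i \<in> X k}"
    have B: "?B k \<in> sets (label_measure I)" for k
    proof -
      have "?B k = {u \<in> space (label_measure I). u s \<in> X k \<and> u t \<in> X k}" by auto
      also have "\<dots> \<in> sets (label_measure I)" using X[of k] unfolding label_measure_def by measurable
      finally show ?thesis .
    qed
    have "Q.prob (?B k) = U.prob (X k) ^ 2" for k
    proof -
      have "emeasure (label_measure I) (?B k) = (\<Prod>i\<in>{s, t}. emeasure ?U (X k))"
        unfolding label_measure_def using st X by (intro emeasure_PiM_Collect) auto
      then show ?thesis
        using st by (simp add: U.emeasure_eq_measure Q.emeasure_eq_measure power2_eq_square flip: ennreal_mult)
    qed
    also have "U.prob (X k) ^ 2 \<le> (1 / n) ^ 2" for k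
      by (rule power_mono[OF small]) simp
    finally have Bk: "Q.prob (?B k) \<le> (1 / n) ^ 2" for k .
    have "{u \<in> space (label_measure I). u s = u t} \<subseteq> (\<Union>k\<in>{..Suc n}. ?B k)"
    proof clarsimp
      fix u :: "'a \<Rightarrow> real"
      show "\<exists>k\<in>{..Suc n}. u t \<in> X k"
      proof (cases "u t \<in> {0..1}")
        case False then show ?thesis by (intro bexI[of _ "Suc n"]) (auto simp: X_def)
      next
        case True
        define k where "k = nat \<lfloor>u t * n\<rfloor>"
        have "\<lfloor>u t * n\<rfloor> \<ge> 0" using True by simp
        then have k: "real k \<le> u t * n" "u t * n < real k + 1" by (auto simp: k_def)
        then have "u t \<in> {real k / n ..< (real k + 1) / n}" using that by (auto simp: field_simps)
        moreover have "u t * n \<le> n" using True by (auto intro: mult_left_le_one_le)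
        then have "k \<le> n" using k by linarith
        ultimately show ?thesis by (intro bexI[of _ k]) (auto simp: X_def)
      qed
    qed
    then have "p \<le> Q.prob (\<Union>k\<in>{..Suc n}. ?B k)"
      unfolding p_def using B by (intro Q.finite_measure_mono) auto
    also have "\<dots> \<le> (\<Sum>k\<in>{..Suc n}. Q.prob (?B k))"
      using B by (intro Q.finite_measure_subadditive_finite) auto
    also have "\<dots> \<le> (\<Sum>k\<in>{..Suc n}. (1 / n) ^ 2)" by (intro sum_mono Bk)
    also have "\<dots> = (real n + 2) / real n ^ 2" by (simp add: power_divide)
    finally show ?thesis using that by (simp add: field_simps)
  qed
  have "p \<le> 0"
  proof (rule ccontr)
    assume "\<not> p \<le> 0"
    \<comment> \<open>The 3 comes from \<open>n + 2 \<le> 3 * n\<close> for positive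
      \<open>n\<close>: a positive \<open>p\<close> would give
      \<open>p * n^2 > 3 * n\<close>.\<close>
    obtain n :: nat where n: "real n > 3 / p" using reals_Archimedean2 by blast
    with \<open>\<not> p \<le> 0\<close> have "n > 0" by (metis not_le of_nat_0 divide_pos_pos zero_less_numeral gr0I less_trans less_irrefl)
    have "3 * real n < (p * n) * n" using n \<open>\<not> p \<le> 0\<close> \<open>n > 0\<close> by (simp add: field_simps)
    also have "\<dots> \<le> real n + 2"
      using \<open>n > 0 \<Longrightarrow> p * real n ^ 2 \<le> real n + 2\<close> \<open>n > 0\<close> by (simp add: power2_eq_square mult.assoc)
    finally show False using \<open>n > 0\<close> by simp
  qed
  then have "p = 0" by (simp add: p_def measure_le_0_iff)
  then have "{u \<in> space (label_measure I). u s = u t} \<in> null_sets (label_measure I)"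
    using eq by (simp add: null_sets_def p_def Q.emeasure_eq_measure)
  then show ?thesis by (rule AE_I') auto
qed

lemma AE_label_inj_on:
  assumes "countable I"
  shows "AE u in label_measure I. inj_on u I"
proof -
  have "AE u in label_measure I. \<forall>s\<in>I. \<forall>t\<in>I. s \<noteq> t \<longrightarrow> u s \<noteq> u t"
    using assms by (simp add: AE_ball_countable AE_label_neq)
  then show ?thesis by (rule AE_mp) (auto simp: inj_on_def)
qed

section \<open>Approximation and mass transport\<close>

text \<open>The sets that can be approximated by sets depending on finitely many coordinates contain
  the one-coordinate cylinders and are closed under complements and countable unions. Approximating
  sets for a union are obtained by truncating it first.\<close>

lemma cylinder_approx:
  assumes "finite_measure \<nu>" and sets_\<nu>: "sets \<nu> = sets (PiM I M)" and "B \<in> sets \<nu>" "\<epsilon> > 0"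
  obtains C J where "C \<in> sets \<nu>" "finite J" "J \<subseteq> I"
    "\<And>x y. x \<in> space \<nu> \<Longrightarrow> y \<in> space \<nu> \<Longrightarrow> (\<And>j. j \<in> J \<Longrightarrow> x j = y j) \<Longrightarrow> x \<in> C \<longleftrightarrow> y \<in> C"
    "measure \<nu> ((B - C) \<union> (C - B)) < \<epsilon>"
proof -
  interpret finite_measure \<nu> by fact
  have sp: "space \<nu> = (\<Pi>\<^sub>E i\<in>I. space (M i))"
    using sets_eq_imp_space_eq[OF sets_\<nu>] by (simp add: space_PiM)
  define cyl where "cyl C J \<longleftrightarrow> C \<in> sets \<nu> \<and> finite J \<and> J \<subseteq> I \<and>
    (\<forall>x\<in>space \<nu>. \<forall>y\<in>space \<nu>. (\<forall>j\<in>J. x j = y j) \<longrightarrow> (x \<in> C \<longleftrightarrow> y \<in> C))" for C J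
  let ?gen = "{{f\<in>\<Pi>\<^sub>E i\<in>I. space (M i). f i \<in> A} | i A. i \<in> I \<and> A \<in> sets (M i)}"
  have gen: "sets \<nu> = sigma_sets (space \<nu>) ?gen"
    unfolding sets_\<nu> sets_PiM_single sp ..
  have "B \<in> sigma_sets (space \<nu>) ?gen" using assms(3) gen by simp
  then have "\<forall>\<epsilon>>0. \<exists>C J. cyl C J \<and> measure \<nu> ((B - C) \<union> (C - B)) < \<epsilon>"
  proof (induction rule: sigma_sets.induct)
    case (Basic a)
    then obtain i where i: "i \<in> I" "\<exists>A. a = {f\<in>\<Pi>\<^sub>E i\<in>I. space (M i). f i \<in> A}" by auto
    have "a \<in> sets \<nu>" unfolding gen using Basic by (rule sigma_sets.Basic)
    with i have "cyl a {i}" by (auto simp: cyl_def sp)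
    then show ?case by (intro allI impI exI[of _ a] exI[of _ "{i}"]) simp
  next
    case Empty
    have "cyl {} {}" by (simp add: cyl_def)
    then show ?case by (intro allI impI exI[of _ "{}"]) simp
  next
    case (Compl a)
    show ?case
    proof (intro allI impI)
      fix \<epsilon> :: real assume "\<epsilon> > 0"
      with Compl.IH obtain C J where C: "cyl C J" "measure \<nu> ((a - C) \<union> (C - a)) < \<epsilon>" by auto
      have a: "a \<in> sets \<nu>" using Compl.hyps by (simp add: gen)
      have "cyl (space \<nu> - C) J"
        using C(1) sets.compl_sets[of C \<nu>] unfolding cyl_def by blast
      moreover have "measure \<nu> ((space \<nu> - a - (space \<nu> - C)) \<union> (space \<nu> - C - (space \<nu> - a))) \<le>
          measure \<nu> ((a - C) \<union> (C - a))"
        using a C(1) unfolding cyl_def by (intro finite_measure_mono) blast+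
      ultimately show "\<exists>C J. cyl C J \<and> measure \<nu> ((space \<nu> - a - C) \<union> (C - (space \<nu> - a))) < \<epsilon>"
        using C(2) by (intro exI[of _ "space \<nu> - C"] exI[of _ J]) auto
    qed
  next
    case (Union a)
    show ?case
    proof (intro allI impI)
      fix \<epsilon> :: real assume \<epsilon>: "\<epsilon> > 0"
      have a: "a i \<in> sets \<nu>" for i using Union.hyps by (simp add: gen)
      let ?A = "\<lambda>n. \<Union>i<n. a i"
      have U: "(\<Union>n. ?A n) = (\<Union>i. a i)" by auto
      have "(\<lambda>n. measure \<nu> (?A n)) \<longlonglongrightarrow> measure \<nu> (\<Union>n. ?A n)"
        using a by (intro finite_Lim_measure_incseq incseq_SucI) (auto simp: less_Suc_eq)
      then have "\<forall>\<^sub>F n in sequentially. measure \<nu> (\<Union>i. a i) - \<epsilon> / 2 < measure \<nu> (?A n)"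
        unfolding U using \<epsilon> by (intro order_tendstoD(1)) auto
      then obtain n where "measure \<nu> (\<Union>i. a i) - \<epsilon> / 2 < measure \<nu> (?A n)"
        by (auto simp: eventually_sequentially)
      then have n: "measure \<nu> (\<Union>i. a i) - measure \<nu> (?A n) < \<epsilon> / 2" by linarith
      \<comment> \<open>Truncation has cost less than \<open>\<epsilon> / 2\<close>; the
        \<open>n\<close> approximations share the other half. The \<open>+ 1\<close> keeps the
        tolerance positive for \<open>n = 0\<close>.\<close>
      have "\<forall>i. \<exists>C J. cyl C J \<and> measure \<nu> ((a i - C) \<union> (C - a i)) < \<epsilon> / (2 * (real n + 1))"
        using Union.IH \<epsilon> by simp
      then obtain C J where C: "\<And>i. cyl (C i) (J i)"
        "\<And>i. measure \<nu> ((a i - C i) \<union> (C i - a i)) < \<epsilon> / (2 * (real n + 1))" by metis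
      have Cs: "C i \<in> sets \<nu>" for i using C(1)[of i] unfolding cyl_def by blast
      let ?C = "\<Union>i<n. C i" and ?B = "\<Union>i. a i"
      have "cyl ?C (\<Union>i<n. J i)"
        unfolding cyl_def
      proof (intro conjI ballI impI)
        show "?C \<in> sets \<nu>" using Cs by auto
        show "finite (\<Union>i<n. J i)" "(\<Union>i<n. J i) \<subseteq> I" using C(1) unfolding cyl_def by blast+
        fix x y assume xy: "x \<in> space \<nu>" "y \<in> space \<nu>" "\<forall>j\<in>(\<Union>i<n. J i). x j = y j"
        then have "x \<in> C i \<longleftrightarrow> y \<in> C i" if "i < n" for i
          using C(1)[of i] that unfolding cyl_def by blast
        then show "x \<in> ?C \<longleftrightarrow> y \<in> ?C" by blast
      qed
      moreover have "measure \<nu> ((?B - ?C) \<union> (?C - ?B)) < \<epsilon>"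
      proof -
        have "measure \<nu> ((?B - ?C) \<union> (?C - ?B)) \<le>
            measure \<nu> ((?B - ?A n) \<union> (\<Union>i<n. (a i - C i) \<union> (C i - a i)))"
          using a Cs by (intro finite_measure_mono) auto
        also have "\<dots> \<le> measure \<nu> (?B - ?A n) + measure \<nu> (\<Union>i<n. (a i - C i) \<union> (C i - a i))"
          using a Cs by (intro measure_Un_le) auto
        also have "measure \<nu> (\<Union>i<n. (a i - C i) \<union> (C i - a i)) \<le> (\<Sum>i<n. measure \<nu> ((a i - C i) \<union> (C i - a i)))"
          using a Cs by (intro finite_measure_subadditive_finite) auto
        also have "\<dots> \<le> (\<Sum>i<n. \<epsilon> / (2 * (real n + 1)))"
          using C(2) by (intro sum_mono less_imp_le) auto
        also have "\<dots> \<le> \<epsilon> / 2" using \<epsilon> by (simp add: field_simps)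
        also have "measure \<nu> (?B - ?A n) = measure \<nu> ?B - measure \<nu> (?A n)"
          using a by (intro finite_measure_Diff) auto
        finally show ?thesis using n by linarith
      qed
      ultimately show "\<exists>C J. cyl C J \<and> measure \<nu> ((?B - C) \<union> (C - ?B)) < \<epsilon>" by blast
    qed
  qed
  with assms(4) obtain C J where "cyl C J" "measure \<nu> ((B - C) \<union> (C - B)) < \<epsilon>" by auto
  then show ?thesis unfolding cyl_def by (intro that[of C J]) blast+
qed

lemma measurable_map_prod:
  assumes [measurable]: "f \<in> M \<rightarrow>\<^sub>M M'" "g \<in> N \<rightarrow>\<^sub>M N'"
  shows "map_prod f g \<in> M \<Otimes>\<^sub>M N \<rightarrow>\<^sub>M M' \<Otimes>\<^sub>M N'"
  unfolding map_prod_def case_prod_unfold by measurable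

text \<open>The event is the increasing union of the events that \<open>P i\<close> holds for all
  \<open>i \<ge> n\<close>, and each of those is contained in a single event of measure at most
  \<open>c\<close>.\<close>

lemma emeasure_eventually_le:
  fixes P :: "nat \<Rightarrow> 'a \<Rightarrow> bool"
  assumes P: "\<And>i. {z \<in> space N. P i z} \<in> sets N" and c: "\<And>i. emeasure N {z \<in> space N. P i z} \<le> c"
  shows "{z \<in> space N. \<forall>\<^sub>F i in sequentially. P i z} \<in> sets N"
    and "emeasure N {z \<in> space N. \<forall>\<^sub>F i in sequentially. P i z} \<le> c"
proof -
  let ?Q = "\<lambda>n. {z \<in> space N. \<forall>i\<in>{n..}. P i z}"
  have Q: "?Q n \<in> sets N" for n using P by (intro sets.sets_Collect_countable_Ball) auto
  have eq: "{z \<in> space N. \<forall>\<^sub>F i in sequentially. P i z} = (\<Union>n. ?Q n)"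
    by (auto simp: eventually_sequentially)
  show "{z \<in> space N. \<forall>\<^sub>F i in sequentially. P i z} \<in> sets N" unfolding eq using Q by auto
  have "(SUP n. emeasure N (?Q n)) = emeasure N (\<Union>n. ?Q n)"
    using Q by (intro SUP_emeasure_incseq) (auto simp: incseq_def)
  moreover have "emeasure N (?Q n) \<le> c" for n
    by (rule order_trans[OF emeasure_mono[OF _ P] c[of n]]) auto
  then have "(SUP n. emeasure N (?Q n)) \<le> c" by (rule SUP_least)
  ultimately show "emeasure N {z \<in> space N. \<forall>\<^sub>F i in sequentially. P i z} \<le> c"
    unfolding eq by simp
qed

context cayley
begin

text \<open>Acting by \<open>inv v\<close> moves a point \<open>a\<close> of \<open>j\<close> to
  \<open>a \<otimes> v\<close>, so \<open>v\<close> is determined by the image of one point, and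
  only finitely many images lie in \<open>S\<close>. Hence a finite window moved far out misses
  \<open>S\<close>.\<close>

lemma finite_translates_hitting:
  assumes "j \<in> sites" "finite S" "S \<subseteq> sites"
  shows "finite {v \<in> carrier \<Gamma>. sa (inv v) j \<in> S}"
proof -
  have one: "finite {v \<in> carrier \<Gamma>. a \<otimes> v = b}" if "a \<in> carrier \<Gamma>" for a b
  proof (rule finite_subset)
    show "{v \<in> carrier \<Gamma>. a \<otimes> v = b} \<subseteq> {inv a \<otimes> b}" using that by (auto simp: m_assoc[symmetric])
  qed simp
  define pts where "pts s = (case s of Vertex b \<Rightarrow> {b} | Edge e \<Rightarrow> e)" for s :: "'g site"
  have fin: "finite (pts s)" if "s \<in> sites" for s
    using that by (auto simp: pts_def cayley_edges_def split: site.split)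
  obtain a where a: "a \<in> pts j" "a \<in> carrier \<Gamma>"
    using assms(1) gen_carrier by (cases j) (auto simp: pts_def cayley_edges_def)
  have "a \<otimes> v \<in> pts (sa (inv v) j)" if "v \<in> carrier \<Gamma>" for v
    using a that by (cases j) (auto simp: pts_def vertex_act_def)
  then have "{v \<in> carrier \<Gamma>. sa (inv v) j \<in> S} \<subseteq> (\<Union>s\<in>S. \<Union>b\<in>pts s. {v \<in> carrier \<Gamma>. a \<otimes> v = b})"
    by blast
  moreover have "finite (\<Union>s\<in>S. \<Union>b\<in>pts s. {v \<in> carrier \<Gamma>. a \<otimes> v = b})"
    using assms fin one[OF a(2)] by blast
  ultimately show ?thesis by (rule finite_subset)
qed

lemma label_measure_act:
  assumes g: "g \<in> carrier \<Gamma>"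
  shows "distr (label_measure edges) (label_measure edges) (labelling_act \<Gamma> edges g) = label_measure edges"
  unfolding label_measure_def labelling_act_def
proof (rule distr_PiM_reindex)
  show "inj_on (sa (inv g)) edges"
    by (rule inj_on_inverseI[of _ "sa g"]) (use sa_inv(2)[OF g] in \<open>auto simp: cayley_sites_def\<close>)
qed (use g sa_edges prob_space_unit in auto)

end

context cayley_percolation
begin

text \<open>Acting by \<open>v\<close> moves \<open>v\<close> to \<open>\<one>\<close>, so
  \<open>\<Delta>\<close> is tested on the labelling as seen from the end of the walk.\<close>

definition lands :: "'g site set \<Rightarrow> ('g site \<Rightarrow> 'l) set \<Rightarrow> 'g \<times> 'g \<Rightarrow> nat \<Rightarrow> ('g site \<Rightarrow> 'l) \<Rightarrow>
    'g site set \<Rightarrow> ('g site \<Rightarrow> real) \<Rightarrow> bool"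
  where "lands D \<Delta> e i \<eta> \<omega> u \<longleftrightarrow>
    e \<in> msforest u \<omega> \<and> labelling_act \<Gamma> D (snd (walk u \<omega> i e)) \<eta> \<in> \<Delta>"

text \<open>Translating the final vertex \<open>v\<close> to \<open>\<one>\<close> turns the events for the various \<open>v\<close> into events with
  distinct starting edges, which are disjoint once the last edge of the walk is prescribed.\<close>

lemma mass_transport:
  fixes \<rho> :: "(('g site \<Rightarrow> 'l::polish_space) \<times> 'g site set) measure" and \<upsilon> :: "('g site \<Rightarrow> real) measure"
  assumes D: "\<And>h s. h \<in> carrier \<Gamma> \<Longrightarrow> s \<in> D \<Longrightarrow> sa h s \<in> D"
    and \<rho>: "prob_space \<rho>" "sets \<rho> = sets (labellings D \<Otimes>\<^sub>M subset_space W)"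
    and \<rho>_act: "\<And>g. g \<in> carrier \<Gamma> \<Longrightarrow>
      distr \<rho> \<rho> (map_prod (labelling_act \<Gamma> D g) (subset_act \<Gamma> g)) = \<rho>"
    and \<upsilon>: "prob_space \<upsilon>" "sets \<upsilon> = sets (labellings edges)"
    and \<upsilon>_act: "\<And>g. g \<in> carrier \<Gamma> \<Longrightarrow> distr \<upsilon> \<upsilon> (labelling_act \<Gamma> edges g) = \<upsilon>"
    and \<Delta>: "\<Delta> \<in> sets (labellings D)" and e: "e \<in> carrier \<Gamma> \<times> carrier \<Gamma>"
  shows "{z \<in> space (\<rho> \<Otimes>\<^sub>M \<upsilon>). lands D \<Delta> e i (fst (fst z)) (snd (fst z)) (snd z)} \<in> sets (\<rho> \<Otimes>\<^sub>M \<upsilon>)"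
    and "emeasure (\<rho> \<Otimes>\<^sub>M \<upsilon>) {z \<in> space (\<rho> \<Otimes>\<^sub>M \<upsilon>). lands D \<Delta> e i (fst (fst z)) (snd (fst z)) (snd z)}
      \<le> of_nat (card steps) * emeasure \<rho> {x \<in> space \<rho>. fst x \<in> \<Delta>}"
proof -
  let ?Bad = "{z \<in> space (\<rho> \<Otimes>\<^sub>M \<upsilon>). lands D \<Delta> e i (fst (fst z)) (snd (fst z)) (snd z)}"
  interpret \<rho>: prob_space \<rho> by fact
  interpret \<upsilon>: prob_space \<upsilon> by fact
  interpret P: pair_prob_space \<rho> \<upsilon> ..
  let ?\<mu> = "\<rho> \<Otimes>\<^sub>M \<upsilon>"
  let ?\<eta> = "\<lambda>z. fst (fst z)" and ?F = "\<lambda>z. msforest (snd z) (snd (fst z))"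
    and ?w = "\<lambda>z. walk (snd z) (snd (fst z)) i"
  have s\<mu>: "sets ?\<mu> = sets ((labellings D \<Otimes>\<^sub>M subset_space W) \<Otimes>\<^sub>M labellings edges)"
    using \<rho>(2) \<upsilon>(2) by (rule sets_pair_measure_cong)
  have sp: "snd (fst z) \<subseteq> W" "snd z \<in> space (labellings edges)" if "z \<in> space ?\<mu>" for z
    using that sets_eq_imp_space_eq[OF \<rho>(2)] sets_eq_imp_space_eq[OF \<upsilon>(2)]
    by (auto simp: space_pair_measure space_subset_space)
  have \<eta>m: "?\<eta> \<in> ?\<mu> \<rightarrow>\<^sub>M labellings D" and \<omega>m: "(\<lambda>z. snd (fst z)) \<in> ?\<mu> \<rightarrow>\<^sub>M subset_space W"
    and um: "snd \<in> ?\<mu> \<rightarrow>\<^sub>M labellings edges"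
    unfolding measurable_cong_sets[OF s\<mu> refl] by measurable
  \<comment> \<open>The last directed edge of the walk is \<open>(r \<otimes> v, v)\<close> with
    \<open>r\<close> in \<open>steps\<close>. Translation by \<open>v\<close> turns it into
    \<open>(r, \<one>)\<close> whatever \<open>v\<close> is, while the starting edge becomes
    \<open>ea v e\<close>; thus \<open>B r v\<close> is carried into \<open>T r v\<close>.\<close>
  define B where "B r v = {z \<in> space ?\<mu>. (e \<in> ?F z \<and> ?w z e = (r \<otimes> v, v)) \<and> labelling_act \<Gamma> D v (?\<eta> z) \<in> \<Delta>}" for r v
  define T where "T r v = {z \<in> space ?\<mu>. (ea v e \<in> ?F z \<and> ?w z (ea v e) = (r, \<one>)) \<and> ?\<eta> z \<in> \<Delta>}" for r v
  have Bs: "B r v \<in> sets ?\<mu>" if "v \<in> carrier \<Gamma>" for r v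
  proof -
    have "Measurable.pred ?\<mu> (\<lambda>z. labelling_act \<Gamma> D v (?\<eta> z) \<in> \<Delta>)"
      using \<Delta> measurable_compose[OF \<eta>m measurable_labelling_act[OF D that]] by (rule pred_sets2)
    from pred_intros_logic(3)[OF pred_walk[OF \<omega>m um] this] show ?thesis unfolding B_def pred_def .
  qed
  have Ts: "T r v \<in> sets ?\<mu>" for r v
  proof -
    have "Measurable.pred ?\<mu> (\<lambda>z. ?\<eta> z \<in> \<Delta>)" using \<Delta> \<eta>m by (rule pred_sets2)
    from pred_intros_logic(3)[OF pred_walk[OF \<omega>m um] this] show ?thesis unfolding T_def pred_def .
  qed
  have Bad: "?Bad = (\<Union>r\<in>steps. \<Union>v\<in>carrier \<Gamma>. B r v)"
  proof safe
    fix z assume "lands D \<Delta> e i (?\<eta> z) (snd (fst z)) (snd z)" and sp: "z \<in> space ?\<mu>"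
    then have z: "e \<in> ?F z" "labelling_act \<Gamma> D (snd (?w z e)) (?\<eta> z) \<in> \<Delta>" by (auto simp: lands_def)
    obtain p q where pq: "?w z e = (p, q)" by (cases "?w z e")
    then have "(p, q) \<in> adj (snd (fst z))"
      using walk_in[OF z(1)] msforest_subset by (metis subsetD)
    from adjD(3,6)[OF this] z sp pq show "z \<in> (\<Union>r\<in>steps. \<Union>v\<in>carrier \<Gamma>. B r v)"
      by (auto simp: B_def)
  qed (auto simp: B_def lands_def)
  show "?Bad \<in> sets ?\<mu>" unfolding Bad
    using Bs finite_steps countable_carrier by (intro sets.finite_UN sets.countable_UN'') auto
  have BT: "emeasure ?\<mu> (B r v) \<le> emeasure ?\<mu> (T r v)" if v: "v \<in> carrier \<Gamma>" and r: "r \<in> carrier \<Gamma>" for r v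
  proof -
    let ?\<Phi> = "map_prod (map_prod (labelling_act \<Gamma> D v) (subset_act \<Gamma> v)) (la v)"
    let ?\<phi> = "map_prod (labelling_act \<Gamma> D v) (subset_act \<Gamma> v)"
    have m1: "?\<phi> \<in> \<rho> \<rightarrow>\<^sub>M \<rho>"
      unfolding measurable_cong_sets[OF \<rho>(2) \<rho>(2)]
      by (intro measurable_map_prod measurable_labelling_act measurable_subset_act D v)
    have m2: "la v \<in> \<upsilon> \<rightarrow>\<^sub>M \<upsilon>"
      unfolding measurable_cong_sets[OF \<upsilon>(2) \<upsilon>(2)] by (intro measurable_labelling_act sa_edges v)
    have "distr \<rho> \<rho> ?\<phi> \<Otimes>\<^sub>M distr \<upsilon> \<upsilon> (la v) = distr ?\<mu> ?\<mu> (\<lambda>(x, y). (?\<phi> x, la v y))"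
      using m1 m2 by (rule pair_measure_distr) (simp add: \<upsilon>_act[OF v] \<upsilon>.sigma_finite_measure_axioms)
    then have inv: "distr ?\<mu> ?\<mu> ?\<Phi> = ?\<mu>"
      unfolding \<rho>_act[OF v] \<upsilon>_act[OF v] map_prod_def[of ?\<phi>] by simp
    have m: "?\<Phi> \<in> ?\<mu> \<rightarrow>\<^sub>M ?\<mu>"
      using m1 m2 by (rule measurable_map_prod)
    have "B r v \<subseteq> ?\<Phi> -` T r v \<inter> space ?\<mu>"
    proof
      fix z assume z: "z \<in> B r v"
      then have zs: "z \<in> space ?\<mu>" and F: "e \<in> ?F z" and w: "?w z e = (r \<otimes> v, v)"
        and \<Delta>: "labelling_act \<Gamma> D v (?\<eta> z) \<in> \<Delta>" by (auto simp: B_def)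
      note sp' = sp[OF zs]
      have F': "ea v e \<in> ?F (?\<Phi> z)"
        using msforest_act[OF v sp'(1), of "fst e" "snd e" "snd z"] F by (simp add: map_prod_def case_prod_unfold)
      have "?w (?\<Phi> z) (ea v e) = ea v (r \<otimes> v, v)"
        using walk_act[OF v sp' F, of i] w by (simp add: map_prod_def case_prod_unfold)
      then have "?w (?\<Phi> z) (ea v e) = (r, \<one>)" using v r by (simp add: vertex_act_def m_assoc)
      moreover have "?\<eta> (?\<Phi> z) = labelling_act \<Gamma> D v (?\<eta> z)" by (simp add: map_prod_def case_prod_unfold)
      ultimately show "z \<in> ?\<Phi> -` T r v \<inter> space ?\<mu>"
        using F' \<Delta> zs measurable_space[OF m zs] by (simp add: T_def)
    qed
    then have "emeasure ?\<mu> (B r v) \<le> emeasure ?\<mu> (?\<Phi> -` T r v \<inter> space ?\<mu>)"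
      using measurable_sets[OF m Ts] by (rule emeasure_mono)
    also have "\<dots> = emeasure (distr ?\<mu> ?\<mu> ?\<Phi>) (T r v)" using m Ts by (rule emeasure_distr[symmetric])
    finally show ?thesis by (simp add: inv)
  qed
  have disjB: "disjoint_family_on (B r) (carrier \<Gamma>)" for r
    by (auto simp: disjoint_family_on_def B_def)
  \<comment> \<open>Iterated contours are injective, so only one starting edge leads to
    \<open>(r, \<one>)\<close>, and \<open>ea v e\<close> determines \<open>v\<close>.\<close>
  have disjT: "disjoint_family_on (T r) (carrier \<Gamma>)" for r
    unfolding disjoint_family_on_def
  proof (intro ballI impI)
    fix v v' assume v: "v \<in> carrier \<Gamma>" "v' \<in> carrier \<Gamma>" "v \<noteq> v'"
    show "T r v \<inter> T r v' = {}"
    proof (rule ccontr)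
      assume "T r v \<inter> T r v' \<noteq> {}"
      then obtain z where "z \<in> T r v" "z \<in> T r v'" by blast
      then have z: "ea v e \<in> ?F z" "ea v' e \<in> ?F z" "?w z (ea v e) = ?w z (ea v' e)"
        by (simp_all add: T_def)
      have "inj_on (?w z) (?F z)"
        unfolding walk_def by (rule contour_graph.inj_on_contour_pow[OF contour_graph_msforest])
      then have "ea v e = ea v' e" using z(3,1,2) by (rule inj_onD)
      then have "va v (fst e) = va v' (fst e)" by (metis fst_map_prod)
      then have "inv v = inv v'" using v e by (auto simp: vertex_act_def)
      with v show False by (metis inv_inv)
    qed
  qed
  have \<Delta>\<rho>: "{x \<in> space \<rho>. fst x \<in> \<Delta>} \<in> sets \<rho>"
  proof -
    have "fst \<in> \<rho> \<rightarrow>\<^sub>M labellings D" unfolding measurable_cong_sets[OF \<rho>(2) refl] by measurable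
    from pred_sets2[OF \<Delta> this] show ?thesis by (simp add: pred_def)
  qed
  have col: "emeasure ?\<mu> (\<Union>v\<in>carrier \<Gamma>. B r v) \<le> emeasure \<rho> {x \<in> space \<rho>. fst x \<in> \<Delta>}" if "r \<in> steps" for r
  proof -
    have "emeasure ?\<mu> (\<Union>v\<in>carrier \<Gamma>. B r v) = (\<integral>\<^sup>+v. emeasure ?\<mu> (B r v) \<partial>count_space (carrier \<Gamma>))"
      using Bs countable_carrier disjB by (rule emeasure_UN_countable)
    also have "\<dots> \<le> (\<integral>\<^sup>+v. emeasure ?\<mu> (T r v) \<partial>count_space (carrier \<Gamma>))"
      using BT steps_carrier that by (intro nn_integral_mono) auto
    also have "\<dots> = emeasure ?\<mu> (\<Union>v\<in>carrier \<Gamma>. T r v)"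
      using Ts countable_carrier disjT by (rule emeasure_UN_countable[symmetric])
    also have "\<dots> \<le> emeasure ?\<mu> ({x \<in> space \<rho>. fst x \<in> \<Delta>} \<times> space \<upsilon>)"
      using \<Delta>\<rho> by (intro emeasure_mono) (auto simp: T_def space_pair_measure)
    also have "\<dots> = emeasure \<rho> {x \<in> space \<rho>. fst x \<in> \<Delta>} * emeasure \<upsilon> (space \<upsilon>)"
      using \<Delta>\<rho> by (rule \<upsilon>.emeasure_pair_measure_Times) simp
    finally show ?thesis by (simp add: \<upsilon>.emeasure_space_1)
  qed
  \<comment> \<open>Each possible last step \<open>r\<close> contributes at most the probability of
    \<open>\<Delta>\<close>, which explains the factor \<open>card steps\<close>.\<close>
  have "emeasure ?\<mu> ?Bad \<le> (\<Sum>r\<in>steps. emeasure ?\<mu> (\<Union>v\<in>carrier \<Gamma>. B r v))"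
    unfolding Bad using Bs finite_steps countable_carrier
    by (intro emeasure_subadditive_finite) (auto intro!: sets.countable_UN'')
  also have "\<dots> \<le> (\<Sum>r\<in>steps. emeasure \<rho> {x \<in> space \<rho>. fst x \<in> \<Delta>})" by (intro sum_mono col)
  finally show "emeasure ?\<mu> ?Bad \<le> of_nat (card steps) * emeasure \<rho> {x \<in> space \<rho>. fst x \<in> \<Delta>}" by simp
qed

end

section \<open>Marginals of product measures and null intersections\<close>

lemma distr_pair_snd:
  assumes "prob_space M" "prob_space N"
  shows "distr (M \<Otimes>\<^sub>M N) N snd = N"
proof (rule measure_eqI)
  interpret M: prob_space M by fact
  interpret N: prob_space N by fact
  fix X assume "X \<in> sets (distr (M \<Otimes>\<^sub>M N) N snd)"
  then have X: "X \<in> sets N" by simp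
  then have "snd -` X \<inter> space (M \<Otimes>\<^sub>M N) = space M \<times> X"
    using sets.sets_into_space by (auto simp: space_pair_measure)
  with X show "emeasure (distr (M \<Otimes>\<^sub>M N) N snd) X = emeasure N X"
    by (simp add: emeasure_distr N.emeasure_pair_measure_Times M.emeasure_space_1)
qed simp

text \<open>Lets estimates for the law of a process with independent labels be pulled back to the
  space on which the process is defined.\<close>

lemma distr_map_prod_fst:
  assumes \<upsilon>: "prob_space \<upsilon>" and f: "f \<in> M \<rightarrow>\<^sub>M S" and "prob_space M"
  shows "distr (M \<Otimes>\<^sub>M \<upsilon>) (distr M S f \<Otimes>\<^sub>M \<upsilon>) (map_prod f id) = distr M S f \<Otimes>\<^sub>M \<upsilon>"
proof -
  have id: "distr \<upsilon> \<upsilon> id = \<upsilon>" by (simp add: id_def)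
  have "distr M S f \<Otimes>\<^sub>M distr \<upsilon> \<upsilon> id = distr (M \<Otimes>\<^sub>M \<upsilon>) (S \<Otimes>\<^sub>M \<upsilon>) (\<lambda>(x, y). (f x, id y))"
    using f by (rule pair_measure_distr)
      (simp_all add: id prob_space_imp_sigma_finite[OF \<upsilon>])
  then have "distr M S f \<Otimes>\<^sub>M \<upsilon> = distr (M \<Otimes>\<^sub>M \<upsilon>) (S \<Otimes>\<^sub>M \<upsilon>) (map_prod f id)"
    by (simp add: id map_prod_def)
  also have "\<dots> = distr (M \<Otimes>\<^sub>M \<upsilon>) (distr M S f \<Otimes>\<^sub>M \<upsilon>) (map_prod f id)"
    by (intro distr_cong sets_pair_measure_cong) auto
  finally show ?thesis ..
qed

lemma AE_ex_notin:
  assumes "\<And>m. B m \<in> sets N" "\<And>m::nat. emeasure N (B m) \<le> ennreal (c / (real m + 1))"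
  shows "AE z in N. \<exists>m. z \<notin> B m"
proof -
  have I: "(\<Inter>m. B m) \<in> sets N" using assms(1) by auto
  have "emeasure N (\<Inter>m. B m) \<le> ennreal (c / (real m + 1))" for m
    by (rule order_trans[OF emeasure_mono[OF _ assms(1)] assms(2)[of m]]) auto
  moreover have "(\<lambda>m. ennreal (c / (real m + 1))) \<longlonglongrightarrow> ennreal 0"
    using tendsto_mult_right_zero[OF LIMSEQ_inverse_real_of_nat, of c]
    by (intro tendsto_ennrealI) (simp add: divide_inverse add.commute)
  ultimately have "emeasure N (\<Inter>m. B m) \<le> ennreal 0"
    by (intro LIMSEQ_le_const) auto
  then have "(\<Inter>m. B m) \<in> null_sets N" using I by (simp add: null_sets_def)
  then show ?thesis by (rule AE_I') auto
qed


section \<open>Comparison of the two types along the common walk\<close>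

theorem proposition2p2:
  fixes \<Gamma> :: "('g, 'b) monoid_scheme"
    and A :: "'g set"
    and D W :: "'g site set"
    and M :: "'w measure"
    and \<eta> \<eta>' :: "'w \<Rightarrow> 'g site \<Rightarrow> 'l::polish_space"
    and \<omega> \<omega>' :: "'w \<Rightarrow> 'g site set"
    and f :: "('g site \<Rightarrow> 'l) \<Rightarrow> 'g site set"
    and x x' :: 'g
    and E :: "'w set"
    and S :: "'w \<Rightarrow> 'g site set"
    and \<A> :: "(('g site \<Rightarrow> 'l) \<times> 'g) set"
  assumes "group \<Gamma>"
    and "finite A" and "A \<subseteq> carrier \<Gamma>" and "generate \<Gamma> A = carrier \<Gamma>"
    and "D \<in> {cayley_vertices \<Gamma>, cayley_edges \<Gamma> A, cayley_sites \<Gamma> A}"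
    and "W \<in> {cayley_vertices \<Gamma>, cayley_edges \<Gamma> A}"
    and "prob_space M"
    and "\<eta> \<in> M \<rightarrow>\<^sub>M labellings D"
    and "\<And>g. g \<in> carrier \<Gamma> \<Longrightarrow>
           distr M (labellings D) (\<lambda>w. labelling_act \<Gamma> D g (\<eta> w)) = distr M (labellings D) \<eta>"
    and "\<omega> \<in> M \<rightarrow>\<^sub>M subset_space W"
    and "f \<in> labellings D \<rightarrow>\<^sub>M subset_space W"
    and "AE w in M. \<omega> w = f (\<eta> w)"
    and "\<And>g. g \<in> carrier \<Gamma> \<Longrightarrow>
           distr M (labellings D \<Otimes>\<^sub>M subset_space W)
             (\<lambda>w. (labelling_act \<Gamma> D g (\<eta> w), subset_act \<Gamma> g (\<omega> w))) =
           distr M (labellings D \<Otimes>\<^sub>M subset_space W) (\<lambda>w. (\<eta> w, \<omega> w))"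
    and "\<eta>' \<in> M \<rightarrow>\<^sub>M labellings D"
    and "\<omega>' \<in> M \<rightarrow>\<^sub>M subset_space W"
    and "AE w in M. \<omega>' w = f (\<eta>' w)"
    and "distr M (labellings D \<Otimes>\<^sub>M subset_space W) (\<lambda>w. (\<eta>' w, \<omega>' w)) =
         distr M (labellings D \<Otimes>\<^sub>M subset_space W) (\<lambda>w. (\<eta> w, \<omega> w))"
    and "x \<in> carrier \<Gamma>" and "x' \<in> carrier \<Gamma>"
    and "E \<in> sets (vimage_algebra (space M) (\<lambda>w. (\<eta> w, \<eta>' w)) (labellings D \<Otimes>\<^sub>M labellings D))"
    and "AE w in M. w \<in> E \<longrightarrow>
           infinite (vertices_of (cluster \<Gamma> A W (\<omega> w) x)) \<and>
           infinite (vertices_of (cluster \<Gamma> A W (\<omega>' w) x'))"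
    and "S \<in> M \<rightarrow>\<^sub>M subset_space (cayley_sites \<Gamma> A)"
    and "AE w in M. w \<in> E \<longrightarrow>
           finite (S w) \<and>
           (\<forall>s\<in>D - S w. \<eta> w s = \<eta>' w s) \<and>
           (\<exists>K\<^sub>0. K\<^sub>0 \<in> components (cluster \<Gamma> A W (\<omega> w) x - S w) \<and>
                 K\<^sub>0 \<in> components (cluster \<Gamma> A W (\<omega>' w) x' - S w) \<and>
                 infinite (vertices_of K\<^sub>0))"
    and "component_property \<Gamma> A D W f \<A>"
  shows "AE w in M. w \<in> E \<longrightarrow> ((\<eta> w, x) \<in> \<A> \<longleftrightarrow> (\<eta>' w, x') \<in> \<A>)"
proof -
  interpret cayley \<Gamma> A
    using assms(1-4) by (simp add: cayley_def cayley_axioms_def)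
  have D: "D \<subseteq> sites" "\<And>g s. g \<in> carrier \<Gamma> \<Longrightarrow> s \<in> D \<Longrightarrow> sa g s \<in> D"
    using assms(5) sa_vertices sa_edges sa_sites by (auto simp: cayley_sites_def)
  interpret cayley_percolation \<Gamma> A W
    by unfold_locales (use assms(6) sa_vertices sa_edges in \<open>auto simp: cayley_sites_def\<close>)
  interpret M: prob_space M by fact
  note \<eta> = assms(8) and \<omega> = assms(10) and \<eta>' = assms(14) and \<omega>' = assms(15)
  let ?L = "labellings D :: ('g site \<Rightarrow> 'l) measure" and ?S = "subset_space W"
  define \<upsilon> where "\<upsilon> = label_measure edges"
  have \<upsilon>: "prob_space \<upsilon>" "sets \<upsilon> = sets (labellings edges)"
    by (simp_all add: \<upsilon>_def prob_space_label_measure sets_label_measure)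
  interpret \<upsilon>: prob_space \<upsilon> by fact
  interpret P: pair_prob_space M \<upsilon> ..
  \<comment> \<open>The probability space is enlarged by a single family of edge labels, shared by
    both percolations. Their common law is \<open>\<rho>\<close>, so one estimate under the product
    of \<open>\<rho>\<close> and \<open>\<upsilon>\<close> serves both.\<close>
  define N where "N = M \<Otimes>\<^sub>M \<upsilon>"
  define \<rho> where "\<rho> = distr M (?L \<Otimes>\<^sub>M ?S) (\<lambda>w. (\<eta> w, \<omega> w))"
  have pair: "(\<lambda>w. (\<eta> w, \<omega> w)) \<in> M \<rightarrow>\<^sub>M ?L \<Otimes>\<^sub>M ?S" "(\<lambda>w. (\<eta>' w, \<omega>' w)) \<in> M \<rightarrow>\<^sub>M ?L \<Otimes>\<^sub>M ?S"
    using \<eta> \<omega> \<eta>' \<omega>' by auto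
  have \<rho>: "prob_space \<rho>" "sets \<rho> = sets (?L \<Otimes>\<^sub>M ?S)"
    by (simp_all add: \<rho>_def M.prob_space_distr pair)
  have \<rho>': "distr M (?L \<Otimes>\<^sub>M ?S) (\<lambda>w. (\<eta>' w, \<omega>' w)) = \<rho>" using assms(17) by (simp add: \<rho>_def)
  have \<rho>_act: "distr \<rho> \<rho> (map_prod (labelling_act \<Gamma> D g) (subset_act \<Gamma> g)) = \<rho>" if g: "g \<in> carrier \<Gamma>" for g
  proof -
    let ?\<phi> = "map_prod (labelling_act \<Gamma> D g) (subset_act \<Gamma> g)"
    have m: "?\<phi> \<in> ?L \<Otimes>\<^sub>M ?S \<rightarrow>\<^sub>M ?L \<Otimes>\<^sub>M ?S"
      by (intro measurable_map_prod measurable_labelling_act measurable_subset_act D g)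
    have "distr \<rho> \<rho> ?\<phi> = distr \<rho> (?L \<Otimes>\<^sub>M ?S) ?\<phi>" by (rule distr_cong) (simp_all add: \<rho>(2))
    also have "\<dots> = distr M (?L \<Otimes>\<^sub>M ?S) (?\<phi> \<circ> (\<lambda>w. (\<eta> w, \<omega> w)))"
      unfolding \<rho>_def using m pair(1) by (rule distr_distr)
    also have "\<dots> = \<rho>" using assms(13)[OF g] by (simp add: comp_def \<rho>_def)
    finally show ?thesis .
  qed
  have \<upsilon>_act: "distr \<upsilon> \<upsilon> (labelling_act \<Gamma> edges g) = \<upsilon>" if "g \<in> carrier \<Gamma>" for g
    using label_measure_act[OF that] by (simp add: \<upsilon>_def)
  \<comment> \<open>By diagonal invariance all types reduce to one event on labellings:
    \<open>v\<close> has the type iff the labelling seen from \<open>v\<close> lies in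
    \<open>B\<close>.\<close>
  define B where "B = (\<lambda>\<eta>. (\<eta>, \<one>\<^bsub>\<Gamma>\<^esub>)) -` \<A>"
  have \<A>: "\<A> \<in> sets (?L \<Otimes>\<^sub>M count_space (carrier \<Gamma>))"
    "\<And>g \<eta> v. g \<in> carrier \<Gamma> \<Longrightarrow> \<eta> \<in> space ?L \<Longrightarrow> v \<in> carrier \<Gamma> \<Longrightarrow>
       (labelling_act \<Gamma> D g \<eta>, va g v) \<in> \<A> \<longleftrightarrow> (\<eta>, v) \<in> \<A>"
    "\<And>\<eta> v w. \<eta> \<in> space ?L \<Longrightarrow> v \<in> carrier \<Gamma> \<Longrightarrow> w \<in> vertices_of (cluster \<Gamma> A W (f \<eta>) v) \<Longrightarrow>
       (\<eta>, v) \<in> \<A> \<longleftrightarrow> (\<eta>, w) \<in> \<A>"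
    using assms(24) unfolding component_property_def by blast+
  have B: "B \<in> sets ?L" unfolding B_def using \<A>(1) by (rule sets_Pair2)
  have type: "(\<eta>, v) \<in> \<A> \<longleftrightarrow> labelling_act \<Gamma> D v \<eta> \<in> B" if "\<eta> \<in> space ?L" "v \<in> carrier \<Gamma>" for \<eta> v
    using \<A>(2)[OF that(2,1,2)] that(2) by (simp add: B_def vertex_act_def)
  define \<nu> where "\<nu> = distr \<rho> ?L fst"
  have fst\<rho>: "fst \<in> \<rho> \<rightarrow>\<^sub>M ?L" unfolding measurable_cong_sets[OF \<rho>(2) refl] by measurable
  have \<nu>: "prob_space \<nu>" "sets \<nu> = sets ?L"
    using prob_space.prob_space_distr[OF \<rho>(1) fst\<rho>] by (simp_all add: \<nu>_def)
  interpret \<nu>: prob_space \<nu> by fact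
  define Q where "Q m C J \<longleftrightarrow> C \<in> sets ?L \<and> finite J \<and> J \<subseteq> D \<and>
      (\<forall>x\<in>space ?L. \<forall>y\<in>space ?L. (\<forall>j\<in>J. x j = y j) \<longrightarrow> (x \<in> C \<longleftrightarrow> y \<in> C)) \<and>
      measure \<nu> ((B - C) \<union> (C - B)) < 1 / (real m + 1)" for m :: nat and C J
  have "\<exists>C J. Q m C J" for m
  proof -
    have "finite_measure \<nu>" "sets \<nu> = sets (\<Pi>\<^sub>M s\<in>D. borel)" "B \<in> sets \<nu>" "1 / (real m + 1) > 0"
      using \<nu> B \<nu>.finite_measure_axioms by (simp_all add: labellings_def)
    then obtain C J where CJ: "C \<in> sets \<nu>" "finite J" "J \<subseteq> D"
      "measure \<nu> ((B - C) \<union> (C - B)) < 1 / (real m + 1)"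
      and loc: "\<And>x y. x \<in> space \<nu> \<Longrightarrow> y \<in> space \<nu> \<Longrightarrow> (\<And>j. j \<in> J \<Longrightarrow> x j = y j) \<Longrightarrow> x \<in> C \<longleftrightarrow> y \<in> C"
      by (rule cylinder_approx) blast
    have "Q m C J" unfolding Q_def
    proof (intro conjI ballI impI)
      show "C \<in> sets ?L" using CJ(1) \<nu>(2) by simp
      fix x y assume "x \<in> space ?L" "y \<in> space ?L" "\<forall>j\<in>J. x j = y j"
      then show "x \<in> C \<longleftrightarrow> y \<in> C"
        by (intro loc) (simp_all add: sets_eq_imp_space_eq[OF \<nu>(2)])
    qed (use CJ(2-4) in simp_all)
    then show ?thesis by blast
  qed
  then obtain C J where Q: "\<And>m. Q m (C m) (J m)" by metis
  have CJ: "C m \<in> sets ?L" "finite (J m)" "J m \<subseteq> D" "measure \<nu> ((B - C m) \<union> (C m - B)) < 1 / (real m + 1)" for m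
    using Q[of m] unfolding Q_def by blast+
  have local: "x \<in> C m \<longleftrightarrow> y \<in> C m"
    if "x \<in> space ?L" "y \<in> space ?L" "\<And>j. j \<in> J m \<Longrightarrow> x j = y j" for m x y
    using Q[of m] that unfolding Q_def by blast
  \<comment> \<open>The labellings for which the finite-range guess \<open>C m\<close> of the type
    of \<open>\<one>\<close> is wrong.\<close>
  define \<Delta> where "\<Delta> m = (B - C m) \<union> (C m - B)" for m
  have \<Delta>: "\<Delta> m \<in> sets ?L" for m using B CJ(1) by (auto simp: \<Delta>_def)
  have \<Delta>\<rho>: "emeasure \<rho> {x \<in> space \<rho>. fst x \<in> \<Delta> m} \<le> ennreal (1 / (real m + 1))" for m
  proof -
    have "emeasure \<rho> {x \<in> space \<rho>. fst x \<in> \<Delta> m} = emeasure \<nu> (\<Delta> m)"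
      unfolding \<nu>_def using fst\<rho> \<Delta> by (subst emeasure_distr) (auto intro!: arg_cong[where f = "emeasure \<rho>"])
    then show ?thesis using CJ(4)[of m] by (simp add: \<nu>.emeasure_eq_measure \<Delta>_def ennreal_leI)
  qed
  \<comment> \<open>One factor \<open>card steps\<close> from mass transport for each of the two
    processes.\<close>
  define K where "K = 2 * real (card steps)"
  let ?hit = "\<lambda>m e i (w, u). lands D (\<Delta> m) e i (\<eta> w) (\<omega> w) u"
    and ?hit' = "\<lambda>m e i (w, u). lands D (\<Delta> m) e i (\<eta>' w) (\<omega>' w) u"
  have one: "{z \<in> space N. case z of (w, u) \<Rightarrow> lands D (\<Delta> m) e i (a w) (b w) u} \<in> sets N \<and>
      emeasure N {z \<in> space N. case z of (w, u) \<Rightarrow> lands D (\<Delta> m) e i (a w) (b w) u}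
        \<le> ennreal (card steps / (real m + 1))"
    if ab: "(\<lambda>w. (a w, b w)) \<in> M \<rightarrow>\<^sub>M ?L \<Otimes>\<^sub>M ?S" and law: "distr M (?L \<Otimes>\<^sub>M ?S) (\<lambda>w. (a w, b w)) = \<rho>"
      and e: "e \<in> carrier \<Gamma> \<times> carrier \<Gamma>" for a b m e i
  proof -
    let ?h = "map_prod (\<lambda>w. (a w, b w)) id :: 'w \<times> ('g site \<Rightarrow> real) \<Rightarrow> _"
    let ?E = "{z \<in> space (\<rho> \<Otimes>\<^sub>M \<upsilon>). lands D (\<Delta> m) e i (fst (fst z)) (snd (fst z)) (snd z)}"
    note mt = mass_transport[OF D(2) \<rho> \<rho>_act \<upsilon> \<upsilon>_act \<Delta>[of m] e, of i]
    have h: "?h \<in> N \<rightarrow>\<^sub>M \<rho> \<Otimes>\<^sub>M \<upsilon>"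
      unfolding N_def law[symmetric] using ab by (intro measurable_map_prod) auto
    have hN: "distr N (\<rho> \<Otimes>\<^sub>M \<upsilon>) ?h = \<rho> \<Otimes>\<^sub>M \<upsilon>"
      using distr_map_prod_fst[OF \<upsilon>(1) ab M.prob_space_axioms] unfolding law N_def .
    have eq: "{z \<in> space N. case z of (w, u) \<Rightarrow> lands D (\<Delta> m) e i (a w) (b w) u} = ?h -` ?E \<inter> space N"
      using measurable_space[OF h] by auto
    have "emeasure N (?h -` ?E \<inter> space N) = emeasure (\<rho> \<Otimes>\<^sub>M \<upsilon>) ?E"
      using emeasure_distr[OF h mt(1)] by (simp add: hN)
    also have "\<dots> \<le> of_nat (card steps) * ennreal (1 / (real m + 1))"
      by (rule order_trans[OF mt(2) mult_left_mono[OF \<Delta>\<rho> zero_le]])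
    also have "\<dots> = ennreal (card steps / (real m + 1))"
      by (simp add: ennreal_of_nat_eq_real_of_nat flip: ennreal_mult)
    finally show ?thesis unfolding eq using measurable_sets[OF h mt(1)] by simp
  qed
  \<comment> \<open>Each disjunct follows the walk of its own process. For the starting edges given
    by \<open>common_walk\<close> the two walks coincide.\<close>
  define Bad where "Bad m e = {z \<in> space N. \<forall>\<^sub>F i in sequentially. ?hit m e i z \<or> ?hit' m e i z}" for m e
  have Bad: "Bad m e \<in> sets N \<and> emeasure N (Bad m e) \<le> ennreal (K / (real m + 1))"
    if e: "e \<in> carrier \<Gamma> \<times> carrier \<Gamma>" for m e
  proof -
    let ?X = "\<lambda>i. {z \<in> space N. ?hit m e i z}" and ?X' = "\<lambda>i. {z \<in> space N. ?hit' m e i z}"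
    have X: "?X i \<in> sets N" "?X' i \<in> sets N" "emeasure N (?X i) \<le> ennreal (card steps / (real m + 1))"
      "emeasure N (?X' i) \<le> ennreal (card steps / (real m + 1))" for i
      using one[OF pair(1) \<rho>_def[symmetric] e] one[OF pair(2) \<rho>' e] by blast+
    have eq: "{z \<in> space N. ?hit m e i z \<or> ?hit' m e i z} = ?X i \<union> ?X' i" for i by auto
    have "emeasure N (?X i \<union> ?X' i) \<le> ennreal (K / (real m + 1))" for i
    proof -
      have "emeasure N (?X i \<union> ?X' i) \<le> emeasure N (?X i) + emeasure N (?X' i)"
        using X by (intro emeasure_subadditive) auto
      also have "\<dots> \<le> ennreal (card steps / (real m + 1)) + ennreal (card steps / (real m + 1))"
        using X by (intro add_mono) auto
      also have "\<dots> = ennreal (K / (real m + 1))"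
        by (simp add: K_def flip: ennreal_plus)
      finally show ?thesis .
    qed
    then show ?thesis unfolding Bad_def
      using X emeasure_eventually_le[of N "\<lambda>i z. ?hit m e i z \<or> ?hit' m e i z" "ennreal (K / (real m + 1))"]
      unfolding eq by auto
  qed
  have AE_N: "AE z in N. P (fst z)" if "AE w in M. P w" for P
  proof -
    have m: "fst \<in> N \<rightarrow>\<^sub>M M" unfolding N_def by simp
    have "distr N M fst = M" unfolding N_def by (rule \<upsilon>.distr_pair_fst)
    from ssubst[OF this, of "\<lambda>X. AE w in X. P w"] that have "AE w in distr N M fst. P w" .
    with m show ?thesis by (rule AE_distrD)
  qed
  have "AE z in N. \<exists>m. z \<notin> Bad m e" if "e \<in> carrier \<Gamma> \<times> carrier \<Gamma>" for e
    using Bad[OF that] by (intro AE_ex_notin) auto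
  \<comment> \<open>The starting edge will depend on \<open>z\<close>, so the exceptional null sets
    of all edges are united here.\<close>
  then have ae1: "AE z in N. \<forall>e\<in>carrier \<Gamma> \<times> carrier \<Gamma>. \<exists>m. z \<notin> Bad m e"
    using countable_carrier by (simp add: AE_ball_countable)
  have snd: "snd \<in> N \<rightarrow>\<^sub>M \<upsilon>" unfolding N_def by simp
  have "distr N \<upsilon> snd = \<upsilon>" unfolding N_def using assms(7) \<upsilon>(1) by (rule distr_pair_snd)
  moreover have "countable edges" using countable_sites by (simp add: cayley_sites_def)
  then have "AE u in \<upsilon>. inj_on u edges" unfolding \<upsilon>_def by (rule AE_label_inj_on)
  ultimately have "AE u in distr N \<upsilon> snd. inj_on u edges"
    by (rule ssubst[of _ _ "\<lambda>X. AE u in X. inj_on u edges"])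
  with snd have ae2: "AE z in N. inj_on (snd z) edges" by (rule AE_distrD)
  have "AE z in N. fst z \<in> E \<longrightarrow> ((\<eta> (fst z), x) \<in> \<A> \<longleftrightarrow> (\<eta>' (fst z), x') \<in> \<A>)"
    using AE_space[of N] ae1 ae2 AE_N[OF assms(12)] AE_N[OF assms(16)] AE_N[OF assms(23)]
  proof (eventually_elim, intro impI)
    fix z assume z: "z \<in> space N" and notbad: "\<forall>e\<in>carrier \<Gamma> \<times> carrier \<Gamma>. \<exists>m. z \<notin> Bad m e"
      and inj: "inj_on (snd z) edges" and f: "\<omega> (fst z) = f (\<eta> (fst z))" "\<omega>' (fst z) = f (\<eta>' (fst z))"
      and "fst z \<in> E"
      and S: "fst z \<in> E \<longrightarrow> finite (S (fst z)) \<and> (\<forall>s\<in>D - S (fst z). \<eta> (fst z) s = \<eta>' (fst z) s) \<and>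
           (\<exists>K\<^sub>0. K\<^sub>0 \<in> components (cluster \<Gamma> A W (\<omega> (fst z)) x - S (fst z)) \<and>
                 K\<^sub>0 \<in> components (cluster \<Gamma> A W (\<omega>' (fst z)) x' - S (fst z)) \<and>
                 infinite (vertices_of K\<^sub>0))"
    obtain w u where wu: "z = (w, u)" by (cases z)
    from S wu \<open>fst z \<in> E\<close> obtain K\<^sub>0 where S: "finite (S w)" "\<And>s. s \<in> D - S w \<Longrightarrow> \<eta> w s = \<eta>' w s"
      and K: "K\<^sub>0 \<in> components (cluster \<Gamma> A W (\<omega> w) x - S w)" "K\<^sub>0 \<in> components (cluster \<Gamma> A W (\<omega>' w) x' - S w)"
        "infinite (vertices_of K\<^sub>0)" by auto
    have w: "w \<in> space M" using z by (auto simp: wu N_def space_pair_measure)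
    have sp: "\<eta> w \<in> space ?L" "\<eta>' w \<in> space ?L" "S w \<subseteq> sites"
      using w measurable_space[OF \<eta>] measurable_space[OF \<eta>'] measurable_space[OF assms(22)]
      by (auto simp: space_subset_space)
    have "inj_on u edges" using inj wu by simp
    from this S(1) K obtain e p where ep: "e \<in> msforest u (\<omega> w)" "e \<in> msforest u (\<omega>' w)"
      "\<And>i. walk u (\<omega> w) i e = p i" "\<And>i. walk u (\<omega>' w) i e = p i"
      "\<And>i. snd (p i) \<in> vertices_of (cluster \<Gamma> A W (\<omega> w) x)" "\<And>i. snd (p i) \<in> vertices_of (cluster \<Gamma> A W (\<omega>' w) x')"
      "\<And>Y. finite Y \<Longrightarrow> \<forall>\<^sub>F i in sequentially. snd (p i) \<notin> Y"
      by (rule common_walk) blast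
    have eE: "e \<in> carrier \<Gamma> \<times> carrier \<Gamma>" using ep(1) msforest_subset adj_carrier by blast
    have pc: "snd (p i) \<in> carrier \<Gamma>" for i
      using walk_in[OF ep(1), of i] msforest_subset[of u "\<omega> w"] adj_carrier[of "\<omega> w"] by (auto simp: ep(3))
    show "(\<eta> (fst z), x) \<in> \<A> \<longleftrightarrow> (\<eta>' (fst z), x') \<in> \<A>"
    proof (rule ccontr)
      assume "\<not> ?thesis"
      then have diff: "(\<eta> w, x) \<in> \<A> \<longleftrightarrow> (\<eta>' w, x') \<notin> \<A>" by (simp add: wu)
      have "z \<in> Bad m e" for m
      proof -
        \<comment> \<open>The vertices \<open>v\<close> from which the window \<open>J m\<close>,
          moved so that \<open>\<one>\<close> goes to \<open>v\<close>, meets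
          \<open>S w\<close>.\<close>
        let ?Y = "\<Union>j\<in>J m. {v \<in> carrier \<Gamma>. sa (inv\<^bsub>\<Gamma>\<^esub> v) j \<in> S w}"
        have "finite ?Y"
          using CJ(2,3) D(1) S(1) sp(3) by (intro finite_UN_I finite_translates_hitting) auto
        then have "\<forall>\<^sub>F i in sequentially. snd (p i) \<notin> ?Y" by (rule ep(7))
        then have "\<forall>\<^sub>F i in sequentially. ?hit m e i z \<or> ?hit' m e i z"
        proof eventually_elim
          fix i assume far: "snd (p i) \<notin> ?Y"
          define v where "v = snd (p i)"
          let ?x = "labelling_act \<Gamma> D v (\<eta> w)" and ?y = "labelling_act \<Gamma> D v (\<eta>' w)"
          have v: "v \<in> carrier \<Gamma>" using pc by (simp add: v_def)
          \<comment> \<open>The walk visits both clusters at once, so the component property carries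
            the type of \<open>x\<close> in \<open>\<eta>\<close> and that of \<open>x'\<close> in
            \<open>\<eta>'\<close> to the same vertex \<open>v\<close>.\<close>
          have "(\<eta> w, x) \<in> \<A> \<longleftrightarrow> (\<eta> w, v) \<in> \<A>" "(\<eta>' w, x') \<in> \<A> \<longleftrightarrow> (\<eta>' w, v) \<in> \<A>"
            using \<A>(3)[OF sp(1) assms(18)] \<A>(3)[OF sp(2) assms(19)] ep(5,6)[of i] f by (simp_all add: v_def wu)
          with diff type[OF sp(1) v] type[OF sp(2) v] have "?x \<in> B \<longleftrightarrow> ?y \<notin> B" by simp
          \<comment> \<open>The window at \<open>v\<close> misses \<open>S w\<close>, so both
            labellings yield the same guess. Since the true types differ, the guess is wrong for one
            of them.\<close>
          moreover have "?x \<in> C m \<longleftrightarrow> ?y \<in> C m"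
          proof (rule local)
            show "?x \<in> space ?L" "?y \<in> space ?L"
              using measurable_space[OF measurable_labelling_act[OF D(2) v]] sp by auto
            fix j assume j: "j \<in> J m"
            then have "j \<in> D" "sa (inv\<^bsub>\<Gamma>\<^esub> v) j \<in> D - S w"
              using CJ(3)[of m] far v D(2)[of "inv\<^bsub>\<Gamma>\<^esub> v" j] by (auto simp: v_def)
            then show "?x j = ?y j" using S(2) by (simp add: labelling_act_def)
          qed
          ultimately have "?x \<in> \<Delta> m \<or> ?y \<in> \<Delta> m" by (auto simp: \<Delta>_def)
          then show "?hit m e i z \<or> ?hit' m e i z" using ep(1-4) by (auto simp: lands_def wu v_def)
        qed
        with z show ?thesis by (simp add: Bad_def)
      qed
      with notbad eE show False by blast
    qed
  qed
  \<comment> \<open>The conclusion does not involve the auxiliary labels, so Fubini brings it back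
    to \<open>M\<close>.\<close>
  then have "AE w in M. AE u in \<upsilon>. w \<in> E \<longrightarrow> ((\<eta> w, x) \<in> \<A> \<longleftrightarrow> (\<eta>' w, x') \<in> \<A>)"
    unfolding N_def by (auto dest: P.AE_pair)
  then show ?thesis by simp
qed

end
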